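(* Let $\mathcal{M}$ be a strong linear Maltsev condition. (1) If the creation-metaquestion for $\mathcal{M}$ is polynomial-time computable and $\mathcal{M}$ has a semiuniform polynomial-time algorithm, then $\mathcal{M}$ has a uniform polynomial-time algorithm. (2) If $\mathcal{M}$ is idempotent, then conversely, if $\mathcal{M}$ has a uniform polynomial-time algorithm, then the creation-metaquestion for $\mathcal{M}$ is polynomial-time computable and $\mathcal{M}$ has a semiuniform polynomial-time algorithm.
   Context: Relational structures have nonempty finite universes and finitely many relations given by explicit lists of tuples; a polymorphism of $\mathbb{H}$ is an operation $H^k\to H$ that, applied coordinatewise to $k$ tuples of any relation, yields a tuple of that relation. A CSP instance is a pair $(\mathbb{G},\mathbb{H})$ of structures of the same type; it is a yes-instance iff there is a homomorphism $\mathbb{G}\to\mathbb{H}$. A strong linear Maltsev condition $\mathcal{M}$ is a finite set of identities of the form $f(x_1,\dots,x_k)\approx g(y_1,\dots,y_n)$ or $f(x_1,\dots,x_k)\approx y$ ($y$ among the variables), over operation symbols $f_1,\dots,f_m$; $\mathbb{H}$ satisfies $\mathcal{M}$ if some polymorphisms of $\mathbb{H}$ interpreting $f_1,\dots,f_m$ satisfy all identities. $\mathcal{M}$ is idempotent if it contains or entails $f(x,\dots,x)\approx x$ for each operation symbol $f$. A uniform polynomial-time algorithm for $\mathcal{M}$ is a polynomial-time algorithm that correctly decides every CSP instance $(\mathbb{G},\mathbb{H})$ in which $\mathbb{H}$ satisfies $\mathcal{M}$. A semiuniform polynomial-time algorithm for $\mathcal{M}$ is a polynomial-time algorithm that, given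 a CSP instance $(\mathbb{G},\mathbb{H})$ together with polymorphisms $f_1,\dots,f_m$ of $\mathbb{H}$ (given by their tables) satisfying $\mathcal{M}$, correctly decides the instance. The creation-metaquestion for $\mathcal{M}$ is the problem: given $\mathbb{H}$, output polymorphisms $f_1,\dots,f_m$ of $\mathbb{H}$ satisfying $\mathcal{M}$ if $\mathbb{H}$ satisfies $\mathcal{M}$, and output ``no'' otherwise. *)

theory Defs
  imports "HOL-Computational_Algebra.Polynomial"
begin

section \<open>Polynomial time\<close>

text \<open>
  The machine model is Jones's WHILE language over binary trees, one of the standard models for
  polynomial time. Every evaluation of a (sub)expression is charged the size of the tree that it
  produces, so that a run of cost \<open>t\<close> only ever builds trees of total size at most \<open>t\<close>, and the
  model and (multi-tape) Turing machines simulate each other with polynomial overhead, for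
  decision problems and for functions alike. The automatically generated \<open>size\<close> of a tree is its
  number of inner nodes.
\<close>

datatype tree = Leaf | Node tree tree

datatype exp = Var nat | Nil_exp | Cons_exp exp exp | Hd exp | Tl exp | Eq exp exp

datatype com =
    Skip
  | Assign nat exp
  | Seq com com
  | If exp com com
  | While exp com

type_synonym state = "nat \<Rightarrow> tree"

fun left :: "tree \<Rightarrow> tree" where
  "left Leaf = Leaf"
| "left (Node l r) = l"

fun right :: "tree \<Rightarrow> tree" where
  "right Leaf = Leaf"
| "right (Node l r) = r"

fun eval :: "exp \<Rightarrow> state \<Rightarrow> tree" where
  "eval (Var x) s = s x"
| "eval Nil_exp s = Leaf"
| "eval (Cons_exp e1 e2) s = Node (eval e1 s) (eval e2 s)"
| "eval (Hd e) s = left (eval e s)"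
| "eval (Tl e) s = right (eval e s)"
| "eval (Eq e1 e2) s = (if eval e1 s = eval e2 s then Node Leaf Leaf else Leaf)"

fun cost :: "exp \<Rightarrow> state \<Rightarrow> nat" where
  "cost (Var x) s = 1 + size (s x)"
| "cost Nil_exp s = 1"
| "cost (Cons_exp e1 e2) s = 1 + size (eval (Cons_exp e1 e2) s) + cost e1 s + cost e2 s"
| "cost (Hd e) s = 1 + size (eval (Hd e) s) + cost e s"
| "cost (Tl e) s = 1 + size (eval (Tl e) s) + cost e s"
| "cost (Eq e1 e2) s = 1 + size (eval (Eq e1 e2) s) + cost e1 s + cost e2 s"

text \<open>
  \<open>exec c s t s'\<close>: started in state \<open>s\<close>, the program \<open>c\<close> terminates in state \<open>s'\<close> after time \<open>t\<close>.
  In tests, \<^const>\<open>Leaf\<close> is false and every other tree is true.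
\<close>

inductive exec :: "com \<Rightarrow> state \<Rightarrow> nat \<Rightarrow> state \<Rightarrow> bool" where
  Skip: "exec Skip s 1 s"
| Assign: "exec (Assign x e) s (1 + cost e s) (s(x := eval e s))"
| Seq: "exec c1 s1 t1 s2 \<Longrightarrow> exec c2 s2 t2 s3 \<Longrightarrow> exec (Seq c1 c2) s1 (1 + t1 + t2) s3"
| IfTrue: "eval e s \<noteq> Leaf \<Longrightarrow> exec c1 s t s' \<Longrightarrow> exec (If e c1 c2) s (1 + cost e s + t) s'"
| IfFalse: "eval e s = Leaf \<Longrightarrow> exec c2 s t s' \<Longrightarrow> exec (If e c1 c2) s (1 + cost e s + t) s'"
| WhileFalse: "eval e s = Leaf \<Longrightarrow> exec (While e c) s (1 + cost e s) s"
| WhileTrue: "eval e s1 \<noteq> Leaf \<Longrightarrow> exec c s1 t1 s2 \<Longrightarrow> exec (While e c) s2 t2 s3 \<Longrightarrow>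
    exec (While e c) s1 (1 + cost e s1 + t1 + t2) s3"

inductive_cases SkipE: "exec Skip s t s'"
inductive_cases AssignE: "exec (Assign x e) s t s'"
inductive_cases SeqE: "exec (Seq c1 c2) s t s'"
inductive_cases IfE: "exec (If e c1 c2) s t s'"
inductive_cases WhileE: "exec (While e c) s t s'"

lemma exec_deterministic:
  "exec c s t s' \<Longrightarrow> exec c s u s'' \<Longrightarrow> t = u \<and> s' = s''"
proof (induction arbitrary: u s'' rule: exec.induct)
  case (Skip s)
  then show ?case by (rule SkipE) simp
next
  case (Assign x e s)
  then show ?case by (rule AssignE) simp
next
  case (Seq c1 s1 t1 s2 c2 t2 s3)
  from Seq.prems show ?case
    by (rule SeqE) (use Seq.IH in fastforce)
next
  case (IfTrue e s c1 t s' c2)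
  from IfTrue.prems show ?case
    by (rule IfE) (use IfTrue.IH IfTrue.hyps(1) in fastforce)+
next
  case (IfFalse e s c2 t s' c1)
  from IfFalse.prems show ?case
    by (rule IfE) (use IfFalse.IH IfFalse.hyps(1) in fastforce)+
next
  case (WhileFalse e s c)
  from WhileFalse.prems show ?case
    by (rule WhileE) (use WhileFalse.hyps(1) in fastforce)+
next
  case (WhileTrue e s1 c t1 s2 t2 s3)
  from WhileTrue.prems show ?case
    by (rule WhileE) (use WhileTrue.hyps(1) WhileTrue.IH in fastforce)+
qed

text \<open>The input is placed in variable 0, where the output is also expected.\<close>

definition init_state :: "tree \<Rightarrow> state" where
  "init_state x = (\<lambda>_. Leaf)(0 := x)"

definition polytime_computable :: "(tree \<Rightarrow> tree) \<Rightarrow> bool" where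
  "polytime_computable f \<longleftrightarrow>
    (\<exists>c (p :: nat poly). \<forall>x. \<exists>t s. exec c (init_state x) t s \<and> s 0 = f x \<and> t \<le> poly p (size x))"

section \<open>Relational structures\<close>

text \<open>
  The universe of a structure is \<open>{0..<univ_size H}\<close>. A relation is given by its arity (needed
  since the relation may be empty) and the list of its tuples.
\<close>

record rel_structure =
  univ_size :: nat
  rels :: "(nat \<times> nat list list) list"

definition universe :: "rel_structure \<Rightarrow> nat set" where
  "universe H = {0..<univ_size H}"

definition is_structure :: "rel_structure \<Rightarrow> bool" where
  "is_structure H \<longleftrightarrow>
    universe H \<noteq> {} \<and>
    (\<forall>(r, ts) \<in> set (rels H). r \<ge> 1 \<and> (\<forall>u \<in> set ts. length u = r \<and> set u \<subseteq> universe H))"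

definition csp_instance :: "rel_structure \<Rightarrow> rel_structure \<Rightarrow> bool" where
  "csp_instance G H \<longleftrightarrow>
    is_structure G \<and> is_structure H \<and> map fst (rels G) = map fst (rels H)"

definition homomorphism :: "(nat \<Rightarrow> nat) \<Rightarrow> rel_structure \<Rightarrow> rel_structure \<Rightarrow> bool" where
  "homomorphism h G H \<longleftrightarrow>
    h ` universe G \<subseteq> universe H \<and>
    (\<forall>i < length (rels G). \<forall>u \<in> set (snd (rels G ! i)). map h u \<in> set (snd (rels H ! i)))"

definition yes_instance :: "rel_structure \<Rightarrow> rel_structure \<Rightarrow> bool" where
  "yes_instance G H \<longleftrightarrow> (\<exists>h. homomorphism h G H)"

text \<open>
  A \<open>k\<close>-ary operation on a set \<open>A\<close> is represented by a function on lists, of which only the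
  restriction to lists of length \<open>k\<close> over \<open>A\<close> is relevant.
\<close>

definition operation_on :: "nat set \<Rightarrow> nat \<Rightarrow> (nat list \<Rightarrow> nat) \<Rightarrow> bool" where
  "operation_on A k f \<longleftrightarrow> (\<forall>a. length a = k \<and> set a \<subseteq> A \<longrightarrow> f a \<in> A)"

definition polymorphism :: "rel_structure \<Rightarrow> nat \<Rightarrow> (nat list \<Rightarrow> nat) \<Rightarrow> bool" where
  "polymorphism H k f \<longleftrightarrow>
    operation_on (universe H) k f \<and>
    (\<forall>(r, ts) \<in> set (rels H). \<forall>us. length us = k \<and> set us \<subseteq> set ts \<longrightarrow>
      map (\<lambda>j. f (map (\<lambda>u. u ! j) us)) [0..<r] \<in> set ts)"

section \<open>Strong linear Maltsev conditions\<close>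

text \<open>
  Operation symbols and variables are natural numbers: \<open>Id_op i xs j ys\<close> is the identity
  \<open>f\<^sub>i(xs) \<approx> f\<^sub>j(ys)\<close>, and \<open>Id_var i xs y\<close> is \<open>f\<^sub>i(xs) \<approx> y\<close>.
\<close>

datatype ident = Id_op nat "nat list" nat "nat list" | Id_var nat "nat list" nat

record maltsev_condition =
  op_arities :: "nat list"
  idents :: "ident set"

fun wf_ident :: "nat list \<Rightarrow> ident \<Rightarrow> bool" where
  "wf_ident ks (Id_op i xs j ys) \<longleftrightarrow>
    i < length ks \<and> length xs = ks ! i \<and> j < length ks \<and> length ys = ks ! j"
| "wf_ident ks (Id_var i xs y) \<longleftrightarrow> i < length ks \<and> length xs = ks ! i \<and> y \<in> set xs"

definition strong_linear_maltsev :: "maltsev_condition \<Rightarrow> bool" where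
  "strong_linear_maltsev M \<longleftrightarrow>
    (\<forall>k \<in> set (op_arities M). k \<ge> 1) \<and> finite (idents M) \<and> (\<forall>e \<in> idents M. wf_ident (op_arities M) e)"

fun ident_holds :: "(nat list \<Rightarrow> nat) list \<Rightarrow> (nat \<Rightarrow> nat) \<Rightarrow> ident \<Rightarrow> bool" where
  "ident_holds fs v (Id_op i xs j ys) \<longleftrightarrow> (fs ! i) (map v xs) = (fs ! j) (map v ys)"
| "ident_holds fs v (Id_var i xs y) \<longleftrightarrow> (fs ! i) (map v xs) = v y"

definition interprets :: "nat set \<Rightarrow> (nat list \<Rightarrow> nat) list \<Rightarrow> maltsev_condition \<Rightarrow> bool" where
  "interprets A fs M \<longleftrightarrow>
    length fs = length (op_arities M) \<and> (\<forall>i < length fs. operation_on A (op_arities M ! i) (fs ! i))"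

definition algebra_satisfies :: "nat set \<Rightarrow> (nat list \<Rightarrow> nat) list \<Rightarrow> maltsev_condition \<Rightarrow> bool" where
  "algebra_satisfies A fs M \<longleftrightarrow>
    interprets A fs M \<and> (\<forall>e \<in> idents M. \<forall>v. range v \<subseteq> A \<longrightarrow> ident_holds fs v e)"

text \<open>
  Idempotence is semantic entailment of \<open>f(x, \<dots>, x) \<approx> x\<close>. By the downward Loewenheim-Skolem
  theorem it suffices to consider countable algebras, i.e. algebras whose universe is (up to
  isomorphism) a nonempty set of natural numbers.
\<close>

definition idempotent :: "maltsev_condition \<Rightarrow> bool" where
  "idempotent M \<longleftrightarrow>
    (\<forall>A fs. A \<noteq> {} \<and> algebra_satisfies A fs M \<longrightarrow>
      (\<forall>i < length (op_arities M). \<forall>a \<in> A. (fs ! i) (replicate (op_arities M ! i) a) = a))"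

definition satisfying_polymorphisms ::
  "rel_structure \<Rightarrow> (nat list \<Rightarrow> nat) list \<Rightarrow> maltsev_condition \<Rightarrow> bool" where
  "satisfying_polymorphisms H fs M \<longleftrightarrow>
    algebra_satisfies (universe H) fs M \<and>
    (\<forall>i < length (op_arities M). polymorphism H (op_arities M ! i) (fs ! i))"

definition satisfies :: "rel_structure \<Rightarrow> maltsev_condition \<Rightarrow> bool" where
  "satisfies H M \<longleftrightarrow> (\<exists>fs. satisfying_polymorphisms H fs M)"

section \<open>Encodings\<close>

text \<open>
  Numbers are encoded in unary. This is polynomially equivalent to binary, since elements are
  bounded by the size of the universe and the arity of a nonempty relation by the length of its
  tuples.
\<close>

fun enc_nat :: "nat \<Rightarrow> tree" where
  "enc_nat 0 = Leaf"
| "enc_nat (Suc n) = Node Leaf (enc_nat n)"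

fun enc_list :: "('a \<Rightarrow> tree) \<Rightarrow> 'a list \<Rightarrow> tree" where
  "enc_list enc [] = Leaf"
| "enc_list enc (x # xs) = Node (enc x) (enc_list enc xs)"

fun enc_option :: "('a \<Rightarrow> tree) \<Rightarrow> 'a option \<Rightarrow> tree" where
  "enc_option enc None = Leaf"
| "enc_option enc (Some x) = Node (enc x) Leaf"

fun enc_bool :: "bool \<Rightarrow> tree" where
  "enc_bool False = Leaf"
| "enc_bool True = Node Leaf Leaf"

definition enc_rel :: "nat \<times> nat list list \<Rightarrow> tree" where
  "enc_rel R = Node (enc_nat (fst R)) (enc_list (enc_list enc_nat) (snd R))"

definition enc_structure :: "rel_structure \<Rightarrow> tree" where
  "enc_structure H = Node (enc_nat (univ_size H)) (enc_list enc_rel (rels H))"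

text \<open>
  The table of a \<open>k\<close>-ary operation on \<open>{0..<n}\<close> lists all argument tuples with their values;
  \<^const>\<open>List.n_lists\<close> enumerates the argument tuples.
\<close>

definition op_table :: "nat \<Rightarrow> nat \<Rightarrow> (nat list \<Rightarrow> nat) \<Rightarrow> (nat list \<times> nat) list" where
  "op_table n k f = map (\<lambda>a. (a, f a)) (List.n_lists k [0..<n])"

definition enc_table :: "(nat list \<times> nat) list \<Rightarrow> tree" where
  "enc_table = enc_list (\<lambda>(a, b). Node (enc_list enc_nat a) (enc_nat b))"

definition op_tables ::
  "rel_structure \<Rightarrow> maltsev_condition \<Rightarrow> (nat list \<Rightarrow> nat) list \<Rightarrow> (nat list \<times> nat) list list" where
  "op_tables H M fs = map2 (op_table (univ_size H)) (op_arities M) fs"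

section \<open>The algorithmic problems\<close>

text \<open>
  In each definition, \<open>alg\<close> runs in polynomial time on all inputs, while its output matters only
  on the (promise) inputs under consideration.
\<close>

definition has_uniform_polytime_algorithm :: "maltsev_condition \<Rightarrow> bool" where
  "has_uniform_polytime_algorithm M \<longleftrightarrow>
    (\<exists>alg. polytime_computable alg \<and>
      (\<forall>G H. csp_instance G H \<and> satisfies H M \<longrightarrow>
        alg (Node (enc_structure G) (enc_structure H)) = enc_bool (yes_instance G H)))"

definition has_semiuniform_polytime_algorithm :: "maltsev_condition \<Rightarrow> bool" where
  "has_semiuniform_polytime_algorithm M \<longleftrightarrow>
    (\<exists>alg. polytime_computable alg \<and>
      (\<forall>G H fs. csp_instance G H \<and> satisfying_polymorphisms H fs M \<longrightarrow>
        alg (Node (Node (enc_structure G) (enc_structure H)) (enc_list enc_table (op_tables H M fs)))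
          = enc_bool (yes_instance G H)))"

text \<open>
  Any choice of satisfying polymorphisms is a correct output; the answer ``no'' is the encoding of
  \<^const>\<open>None\<close>.
\<close>

definition creation_output :: "maltsev_condition \<Rightarrow> rel_structure \<Rightarrow> tree \<Rightarrow> bool" where
  "creation_output M H out \<longleftrightarrow>
    (if satisfies H M
     then \<exists>fs. satisfying_polymorphisms H fs M \<and>
            out = enc_option (enc_list enc_table) (Some (op_tables H M fs))
     else out = enc_option (enc_list enc_table) None)"

definition creation_metaquestion_polytime :: "maltsev_condition \<Rightarrow> bool" where
  "creation_metaquestion_polytime M \<longleftrightarrow>
    (\<exists>alg. polytime_computable alg \<and>
      (\<forall>H. is_structure H \<longrightarrow> creation_output M H (alg (enc_structure H))))"

end

theory Submission
  imports Defs
begin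

text \<open>
  Part (1) and the semiuniform half of part (2) are compositions of algorithms. For the creation
  half of (2), satisfying polymorphisms of \<open>H\<close> are the homomorphisms from an indicator structure,
  whose elements are the unknown table entries of the operations, to the expansion of \<open>H\<close> by the
  equality relation (which expresses the identities between operations without taking a quotient)
  and by all singletons (which allow one to prescribe table entries). Since \<open>M\<close> is idempotent, the
  expansion satisfies \<open>M\<close> if \<open>H\<close> does, so that the uniform algorithm can be used to fix the entries
  one after the other. If \<open>H\<close> does not satisfy \<open>M\<close>, the answers of the uniform algorithm are
  worthless, but then the final check of the tables fails.

  Polynomial running time is obtained from closure properties of the class of functions computable
  in polynomial time, above all under folds whose accumulator stays small.
\<close>

section \<open>Closure properties of polynomial time\<close>

text \<open>Algorithms are functions on trees (mostly with prefix \<open>t\<close>), each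
  accompanied by a \<open>pt_\<close> rule and an \<open>_enc\<close> equation that relates it to
  the mathematical object; actual WHILE programs are written only for a few primitives. Since
  \<open>M\<close> is fixed, its arities, identities and variables are constants of the program:
  loops over them are unrolled, and the \<open>n ^ k\<close> entries of a table are polynomially
  many. The obstacle in the self-reduction is the promise: the uniform algorithm is reliable only on
  templates satisfying \<open>M\<close>, so the choices made so far must not change the template.
  Therefore the singletons of all elements are present from the start, and a choice only puts one
  more key into a unary relation of the left-hand structure. An assignment that passes the final
  check is itself a witness for \<open>satisfies H M\<close>, so wrong answers cannot produce a
  wrong table.\<close>

definition poly_bounded :: "(nat \<Rightarrow> nat) \<Rightarrow> bool" where
  "poly_bounded b \<longleftrightarrow> (\<exists>p :: nat poly. \<forall>n. b n \<le> poly p n)"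

text \<open>Coefficients in \<open>nat\<close> are nonnegative. Monotonicity is what allows a size
  bound to be substituted into a time bound.\<close>

lemma poly_nat_mono: "m \<le> n \<Longrightarrow> poly (p :: nat poly) m \<le> poly p n"
  by (induction p) (auto intro!: add_mono mult_mono)

lemma poly_bounded_poly: "poly_bounded (poly p)"
  by (auto simp: poly_bounded_def)

lemma poly_bounded_const: "poly_bounded (\<lambda>_. c)"
  unfolding poly_bounded_def by (rule exI[of _ "[:c:]"]) simp

lemma poly_bounded_id: "poly_bounded (\<lambda>n. n)"
  unfolding poly_bounded_def by (rule exI[of _ "[:0, 1:]"]) simp

lemma poly_bounded_add:
  assumes "poly_bounded a" "poly_bounded b"
  shows "poly_bounded (\<lambda>n. a n + b n)"
proof -
  obtain p q :: "nat poly" where "\<forall>n. a n \<le> poly p n" "\<forall>n. b n \<le> poly q n"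
    using assms by (auto simp: poly_bounded_def)
  then have "\<forall>n. a n + b n \<le> poly (p + q) n"
    by (auto intro: add_mono)
  then show ?thesis
    unfolding poly_bounded_def by blast
qed

lemma poly_bounded_mult:
  assumes "poly_bounded a" "poly_bounded b"
  shows "poly_bounded (\<lambda>n. a n * b n)"
proof -
  obtain p q :: "nat poly" where "\<forall>n. a n \<le> poly p n" "\<forall>n. b n \<le> poly q n"
    using assms by (auto simp: poly_bounded_def)
  then have "\<forall>n. a n * b n \<le> poly (p * q) n"
    by (auto intro: mult_mono)
  then show ?thesis
    unfolding poly_bounded_def by blast
qed

lemma poly_bounded_compose:
  assumes "poly_bounded b"
  shows "poly_bounded (\<lambda>n. poly p (b n))"
proof -
  obtain q :: "nat poly" where q: "\<forall>n. b n \<le> poly q n"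
    using assms by (auto simp: poly_bounded_def)
  have "\<forall>n. poly p (b n) \<le> poly (pcompose p q) n"
    using q by (simp add: poly_pcompose poly_nat_mono)
  then show ?thesis
    unfolding poly_bounded_def by blast
qed

lemmas poly_bounded_intros =
  poly_bounded_const poly_bounded_id poly_bounded_poly poly_bounded_compose
  poly_bounded_add poly_bounded_mult

text \<open>Lets running times be written as plain arithmetic terms;
  \<open>poly_bounded_intros\<close> then supplies the polynomial.\<close>

lemma polytime_computableI:
  assumes "poly_bounded b"
    and "\<And>x. \<exists>t s. exec c (init_state x) t s \<and> s 0 = f x \<and> t \<le> b (size x)"
  shows "polytime_computable f"
proof -
  obtain p :: "nat poly" where "\<forall>n. b n \<le> poly p n"
    using assms(1) by (auto simp: poly_bounded_def)
  then show ?thesis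
    unfolding polytime_computable_def using assms(2) by (meson le_trans)
qed

text \<open>Every assignment is charged at least the size of the value that it stores.\<close>

lemma exec_size: "exec c s t s' \<Longrightarrow> size (s' i) \<le> size (s i) + t"
proof (induction rule: exec.induct)
  case (Assign x e s)
  have "size (eval e s) \<le> cost e s"
    by (cases e) auto
  then show ?case by auto
qed auto

lemma polytime_computable_size:
  assumes "polytime_computable f"
  shows "\<exists>p :: nat poly. \<forall>x. size (f x) \<le> poly p (size x)"
proof -
  obtain c and p :: "nat poly"
    where cp: "\<forall>x. \<exists>t s. exec c (init_state x) t s \<and> s 0 = f x \<and> t \<le> poly p (size x)"
    using assms by (auto simp: polytime_computable_def)
  \<comment> \<open>The summand \<open>[:0, 1:]\<close> pays for the input, which occupies register
    0 from the start.\<close>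
  have "size (f x) \<le> poly ([:0, 1:] + p) (size x)" for x
  proof -
    obtain t s where "exec c (init_state x) t s" "s 0 = f x" "t \<le> poly p (size x)"
      using cp by blast
    with exec_size[of c "init_state x" t s 0] show ?thesis
      by (simp add: init_state_def)
  qed
  then show ?thesis by blast
qed

section \<open>Relocating programs to higher registers\<close>

fun vars_exp :: "exp \<Rightarrow> nat set" where
  "vars_exp (Var x) = {x}"
| "vars_exp Nil_exp = {}"
| "vars_exp (Cons_exp e1 e2) = vars_exp e1 \<union> vars_exp e2"
| "vars_exp (Hd e) = vars_exp e"
| "vars_exp (Tl e) = vars_exp e"
| "vars_exp (Eq e1 e2) = vars_exp e1 \<union> vars_exp e2"

fun vars_com :: "com \<Rightarrow> nat set" where
  "vars_com Skip = {}"
| "vars_com (Assign x e) = insert x (vars_exp e)"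
| "vars_com (Seq c1 c2) = vars_com c1 \<union> vars_com c2"
| "vars_com (If e c1 c2) = vars_exp e \<union> vars_com c1 \<union> vars_com c2"
| "vars_com (While e c) = vars_exp e \<union> vars_com c"

lemma finite_vars_exp: "finite (vars_exp e)"
  by (induction e) auto

lemma finite_vars_com: "finite (vars_com c)"
  by (induction c) (auto simp: finite_vars_exp)

fun shift_exp :: "nat \<Rightarrow> exp \<Rightarrow> exp" where
  "shift_exp d (Var x) = Var (x + d)"
| "shift_exp d Nil_exp = Nil_exp"
| "shift_exp d (Cons_exp e1 e2) = Cons_exp (shift_exp d e1) (shift_exp d e2)"
| "shift_exp d (Hd e) = Hd (shift_exp d e)"
| "shift_exp d (Tl e) = Tl (shift_exp d e)"
| "shift_exp d (Eq e1 e2) = Eq (shift_exp d e1) (shift_exp d e2)"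

fun shift_com :: "nat \<Rightarrow> com \<Rightarrow> com" where
  "shift_com d Skip = Skip"
| "shift_com d (Assign x e) = Assign (x + d) (shift_exp d e)"
| "shift_com d (Seq c1 c2) = Seq (shift_com d c1) (shift_com d c2)"
| "shift_com d (If e c1 c2) = If (shift_exp d e) (shift_com d c1) (shift_com d c2)"
| "shift_com d (While e c) = While (shift_exp d e) (shift_com d c)"

lemma eval_shift:
  "\<forall>i \<in> vars_exp e. S (i + d) = s i \<Longrightarrow> eval (shift_exp d e) S = eval e s"
  by (induction e) auto

lemma cost_shift:
  "\<forall>i \<in> vars_exp e. S (i + d) = s i \<Longrightarrow> cost (shift_exp d e) S = cost e s"
  by (induction e) (auto simp: eval_shift[of _ S d s])

text \<open>\<open>V\<close> is a fixed superset of the variables of \<open>c\<close>, so that the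
  same invariant passes through all subprograms and loop iterations. Registers below
  \<open>d\<close> are out of reach because every shifted index is at least
  \<open>d\<close>.\<close>

lemma exec_shift:
  assumes "exec c s t s'" "vars_com c \<subseteq> V" "\<forall>i \<in> V. S (i + d) = s i"
  shows "\<exists>S'. exec (shift_com d c) S t S' \<and> (\<forall>i \<in> V. S' (i + d) = s' i) \<and> (\<forall>i < d. S' i = S i)"
  using assms
proof (induction arbitrary: S rule: exec.induct)
  case (Skip s)
  then show ?case using exec.Skip[of S] by auto
next
  case (Assign x e s)
  then have e: "eval (shift_exp d e) S = eval e s" "cost (shift_exp d e) S = cost e s"
    by (intro eval_shift cost_shift; auto)+
  have "exec (shift_com d (Assign x e)) S (1 + cost e s) (S(x + d := eval e s))"
    using exec.Assign[of "x + d" "shift_exp d e" S] by (simp add: e)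
  then show ?case
    using Assign by (intro exI conjI) auto
next
  case (Seq c1 s1 t1 s2 c2 t2 s3)
  then obtain S2 where 2: "exec (shift_com d c1) S t1 S2" "\<forall>i \<in> V. S2 (i + d) = s2 i"
    "\<forall>i < d. S2 i = S i"
    by (metis le_sup_iff vars_com.simps(3))
  then obtain S3 where 3: "exec (shift_com d c2) S2 t2 S3" "\<forall>i \<in> V. S3 (i + d) = s3 i"
    "\<forall>i < d. S3 i = S2 i"
    using Seq by (metis le_sup_iff vars_com.simps(3))
  with 2 show ?case
    using exec.Seq[OF 2(1) 3(1)] by (intro exI[of _ S3]) auto
next
  case (IfTrue e s c1 t s' c2)
  then have e: "eval (shift_exp d e) S = eval e s" "cost (shift_exp d e) S = cost e s"
    by (intro eval_shift cost_shift; auto)+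
  obtain S' where S': "exec (shift_com d c1) S t S'" "\<forall>i \<in> V. S' (i + d) = s' i"
    "\<forall>i < d. S' i = S i"
    using IfTrue by (metis le_sup_iff vars_com.simps(4))
  then show ?case
    using exec.IfTrue[OF _ S'(1), of "shift_exp d e"] IfTrue.hyps(1) by (intro exI[of _ S']) (auto simp: e)
next
  case (IfFalse e s c2 t s' c1)
  then have e: "eval (shift_exp d e) S = eval e s" "cost (shift_exp d e) S = cost e s"
    by (intro eval_shift cost_shift; auto)+
  obtain S' where S': "exec (shift_com d c2) S t S'" "\<forall>i \<in> V. S' (i + d) = s' i"
    "\<forall>i < d. S' i = S i"
    using IfFalse by (metis le_sup_iff vars_com.simps(4))
  then show ?case
    using exec.IfFalse[OF _ S'(1), of "shift_exp d e"] IfFalse.hyps(1) by (intro exI[of _ S']) (auto simp: e)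
next
  case (WhileFalse e s c)
  then have e: "eval (shift_exp d e) S = eval e s" "cost (shift_exp d e) S = cost e s"
    by (intro eval_shift cost_shift; auto)+
  then have "exec (shift_com d (While e c)) S (1 + cost e s) S"
    using exec.WhileFalse[of "shift_exp d e" S] WhileFalse.hyps by simp
  then show ?case
    using WhileFalse by blast
next
  case (WhileTrue e s1 c t1 s2 t2 s3)
  then have e: "eval (shift_exp d e) S = eval e s1" "cost (shift_exp d e) S = cost e s1"
    by (intro eval_shift cost_shift; auto)+
  obtain S2 where 2: "exec (shift_com d c) S t1 S2" "\<forall>i \<in> V. S2 (i + d) = s2 i"
    "\<forall>i < d. S2 i = S i"
    using WhileTrue by (metis le_sup_iff vars_com.simps(5))
  then obtain S3 where 3: "exec (shift_com d (While e c)) S2 t2 S3" "\<forall>i \<in> V. S3 (i + d) = s3 i"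
    "\<forall>i < d. S3 i = S2 i"
    using WhileTrue by blast
  then have "exec (shift_com d (While e c)) S (1 + cost e s1 + t1 + t2) S3"
    using exec.WhileTrue[of "shift_exp d e" S "shift_com d c" t1 S2 t2 S3] WhileTrue.hyps(1) 2
    by (simp add: e)
  with 2 3 show ?case
    by (intro exI[of _ S3]) auto
qed

text \<open>Register \<open>d\<close> itself is spared, since it will hold the input of the
  subroutine.\<close>

fun clear :: "nat \<Rightarrow> nat \<Rightarrow> com" where
  "clear d 0 = Skip"
| "clear d (Suc n) = Seq (clear d n) (Assign (Suc (n + d)) Nil_exp)"

lemma exec_clear:
  "exec (clear d n) s (1 + 3 * n) (\<lambda>i. if d < i \<and> i \<le> d + n then Leaf else s i)"
proof (induction n)
  case 0
  have "(\<lambda>i. if d < i \<and> i \<le> d + 0 then Leaf else s i) = s" by (auto simp: fun_eq_iff)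
  then show ?case using exec.Skip[of s] by simp
next
  case (Suc n)
  let ?s = "\<lambda>i. if d < i \<and> i \<le> d + n then Leaf else s i"
  have "(\<lambda>i. if d < i \<and> i \<le> d + Suc n then Leaf else s i) = ?s(Suc (n + d) := eval Nil_exp ?s)"
    by (auto simp: fun_eq_iff)
  then show ?case
    using exec.Seq[OF Suc exec.Assign[of "Suc (n + d)" Nil_exp ?s]]
    by (simp add: numeral_eq_Suc)
qed

text \<open>Unlike \<open>polytime_computable\<close>, this speaks about arbitrary start states and
  guarantees that registers below \<open>d\<close> survive, so that a caller can keep its own data
  there.\<close>

definition computes :: "nat \<Rightarrow> com \<Rightarrow> (tree \<Rightarrow> tree) \<Rightarrow> nat poly \<Rightarrow> bool" where
  "computes d c f p \<longleftrightarrow> (\<forall>s. \<exists>t s'. exec c s t s' \<and> s' d = f (s d) \<and> (\<forall>i < d. s' i = s i) \<and>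
     t \<le> poly p (size (s d)))"

lemma computesE:
  assumes "computes d c f p"
  obtains t s' where "exec c s t s'" "s' d = f (s d)" "\<And>i. i < d \<Longrightarrow> s' i = s i"
    "t \<le> poly p (size (s d))"
  using assms unfolding computes_def by blast

text \<open>A program can be run as a subroutine on the registers from \<open>d\<close> on, which may contain garbage.\<close>

lemma polytime_computable_computes:
  assumes "polytime_computable f"
  obtains c p where "computes d c f p"
proof -
  obtain c and p :: "nat poly"
    where cp: "\<forall>x. \<exists>t s. exec c (init_state x) t s \<and> s 0 = f x \<and> t \<le> poly p (size x)"
    using assms by (auto simp: polytime_computable_def)
  obtain k where k: "vars_com c \<subseteq> {..k}"
    by (meson finite_nat_iff_bounded_le finite_vars_com)
  \<comment> \<open>Clearing costs \<open>1 + 3 * k\<close> and the sequencing one more. Registers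
    beyond \<open>d + k\<close> may keep their garbage, as the shifted program does not mention
    them.\<close>
  have "computes d (Seq (clear d k) (shift_com d c)) f ([:2 + 3 * k:] + p)"
    unfolding computes_def
  proof
    fix s :: state
    obtain t s' where t: "exec c (init_state (s d)) t s'" "s' 0 = f (s d)" "t \<le> poly p (size (s d))"
      using cp by blast
    let ?s = "\<lambda>i. if d < i \<and> i \<le> d + k then Leaf else s i"
    have "\<forall>i \<in> {..k}. ?s (i + d) = init_state (s d) i"
      by (auto simp: init_state_def)
    from exec_shift[OF t(1) k this] obtain S' where
      S: "exec (shift_com d c) ?s t S'" "\<forall>i \<in> {..k}. S' (i + d) = s' i" "\<forall>i < d. S' i = ?s i"
      by blast
    have "S' (0 + d) = s' 0"
      using S(2) by blast
    moreover have "exec (Seq (clear d k) (shift_com d c)) s (1 + (1 + 3 * k) + t) S'"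
      by (rule exec.Seq[OF exec_clear S(1)])
    ultimately show "\<exists>t s'. exec (Seq (clear d k) (shift_com d c)) s t s' \<and> s' d = f (s d) \<and>
        (\<forall>i < d. s' i = s i) \<and> t \<le> poly ([:2 + 3 * k:] + p) (size (s d))"
      using S(3) t(2,3) by (intro exI conjI) auto
  qed
  then show thesis by (rule that)
qed

section \<open>Composition, pairing, branching and loops\<close>

lemma pt_id: "polytime_computable (\<lambda>x. x)"
proof (rule polytime_computableI[of "\<lambda>_. 1" Skip])
  show "\<exists>t s. exec Skip (init_state x) t s \<and> s 0 = x \<and> t \<le> 1" for x
    by (rule exI, rule exI, rule conjI, rule exec.Skip) (simp add: init_state_def)
qed (intro poly_bounded_intros)

lemma pt_assign:
  assumes "poly_bounded b"
    and "\<And>x. eval e (init_state x) = f x" "\<And>x. cost e (init_state x) \<le> b (size x)"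
  shows "polytime_computable f"
proof (rule polytime_computableI[of "\<lambda>n. 1 + b n" "Assign 0 e"])
  show "\<exists>t s. exec (Assign 0 e) (init_state x) t s \<and> s 0 = f x \<and> t \<le> 1 + b (size x)" for x
    using exec.Assign[of 0 e "init_state x"] assms(2,3) by fastforce
qed (intro poly_bounded_intros assms)

text \<open>The time of \<open>f\<close> is measured in the size of the intermediate result
  \<open>g x\<close>, which is polynomial in the size of \<open>x\<close> because time bounds output
  size.\<close>

lemma pt_compose:
  assumes "polytime_computable f" "polytime_computable g"
  shows "polytime_computable (\<lambda>x. f (g x))"
proof -
  obtain cf pf where f: "computes 0 cf f pf"
    using polytime_computable_computes[OF assms(1)] .
  obtain cg pg where g: "computes 0 cg g pg"
    using polytime_computable_computes[OF assms(2)] .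
  obtain qg :: "nat poly" where qg: "\<And>x. size (g x) \<le> poly qg (size x)"
    using polytime_computable_size[OF assms(2)] by blast
  show ?thesis
  proof (rule polytime_computableI[of "\<lambda>n. 1 + poly pg n + poly pf (poly qg n)" "Seq cg cf"])
    fix x
    obtain t1 s1 where 1: "exec cg (init_state x) t1 s1" "s1 0 = g x" "t1 \<le> poly pg (size x)"
      using computesE[OF g, of "init_state x"] by (auto simp: init_state_def)
    obtain t2 s2 where 2: "exec cf s1 t2 s2" "s2 0 = f (g x)" "t2 \<le> poly pf (size (g x))"
      using computesE[OF f, of s1] 1 by auto
    have "t2 \<le> poly pf (poly qg (size x))"
      using 2(3) poly_nat_mono[OF qg] le_trans by blast
    with 1 2 have "1 + t1 + t2 \<le> 1 + poly pg (size x) + poly pf (poly qg (size x))"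
      by simp
    with exec.Seq[OF 1(1) 2(1)] 2(2)
    show "\<exists>t s. exec (Seq cg cf) (init_state x) t s \<and> s 0 = f (g x) \<and>
        t \<le> 1 + poly pg (size x) + poly pf (poly qg (size x))"
      by blast
  qed (intro poly_bounded_intros)
qed

text \<open>The subroutine for \<open>f\<close> runs from register 1 on, so the input survives in
  register 0; the one for \<open>g\<close> runs from register 2 on, so the result of
  \<open>f\<close> survives in register 1.\<close>

lemma pt_Node:
  assumes "polytime_computable f" "polytime_computable g"
  shows "polytime_computable (\<lambda>x. Node (f x) (g x))"
proof -
  obtain cf pf where f: "computes 1 cf f pf"
    using polytime_computable_computes[OF assms(1)] .
  obtain cg pg where g: "computes 2 cg g pg"
    using polytime_computable_computes[OF assms(2)] .
  obtain qf :: "nat poly" where qf: "\<And>x. size (f x) \<le> poly qf (size x)"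
    using polytime_computable_size[OF assms(1)] by blast
  obtain qg :: "nat poly" where qg: "\<And>x. size (g x) \<le> poly qg (size x)"
    using polytime_computable_size[OF assms(2)] by blast
  let ?c = "Seq (Assign 1 (Var 0)) (Seq cf (Seq (Assign 2 (Var 0))
    (Seq cg (Assign 0 (Cons_exp (Var 1) (Var 2))))))"
  let ?b = "\<lambda>n. 20 + 2 * n + poly pf n + poly pg n + 2 * poly qf n + 2 * poly qg n"
  show ?thesis
  proof (rule polytime_computableI[of ?b ?c])
    fix x
    let ?s1 = "(init_state x)(1 := eval (Var 0) (init_state x))"
    obtain t2 s2 where 2: "exec cf ?s1 t2 s2" "s2 1 = f x" "s2 0 = x" "t2 \<le> poly pf (size x)"
      using computesE[OF f, of ?s1] by (auto simp: init_state_def)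
    let ?s3 = "s2(2 := eval (Var 0) s2)"
    obtain t4 s4 where s4: "exec cg ?s3 t4 s4" "s4 2 = g (?s3 2)" "\<And>i. i < 2 \<Longrightarrow> s4 i = ?s3 i"
      "t4 \<le> poly pg (size (?s3 2))"
      using computesE[OF g, of ?s3] by blast
    have 4: "s4 2 = g x" "s4 1 = f x" "t4 \<le> poly pg (size x)"
      using s4(2,4) s4(3)[of 1] 2 by auto
    note ex = exec.Seq[OF exec.Assign exec.Seq[OF 2(1) exec.Seq[OF exec.Assign
      exec.Seq[OF s4(1) exec.Assign[of 0 "Cons_exp (Var 1) (Var 2)"]]]]]
    show "\<exists>t s. exec ?c (init_state x) t s \<and> s 0 = Node (f x) (g x) \<and> t \<le> ?b (size x)"
      by (rule exI, rule exI, rule conjI, rule ex)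
        (use 2 4 qf[of x] qg[of x] in \<open>auto simp: init_state_def\<close>)
  qed (intro poly_bounded_intros)
qed

text \<open>Stated for a composite argument, as are most later rules, so that \<open>intro\<close>
  can take a nested term apart without explicit compositions.\<close>

lemma pt_left: "polytime_computable f \<Longrightarrow> polytime_computable (\<lambda>x. left (f x))"
proof (erule pt_compose[rotated])
  have "size (left x) \<le> size x" for x by (cases x) auto
  then show "polytime_computable left"
    by (intro pt_assign[of "\<lambda>n. 2 + 2 * n" "Hd (Var 0)"] poly_bounded_intros)
       (auto simp: init_state_def)
qed

lemma pt_right: "polytime_computable f \<Longrightarrow> polytime_computable (\<lambda>x. right (f x))"
proof (erule pt_compose[rotated])
  have "size (right x) \<le> size x" for x by (cases x) auto
  then show "polytime_computable right"
    by (intro pt_assign[of "\<lambda>n. 2 + 2 * n" "Tl (Var 0)"] poly_bounded_intros)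
       (auto simp: init_state_def)
qed

lemma pt_const: "polytime_computable (\<lambda>_. c)"
proof (induction c)
  case Leaf
  show ?case
    by (intro pt_assign[of "\<lambda>_. 1" "Nil_exp"] poly_bounded_intros) auto
qed (rule pt_Node)

lemma pt_eq:
  assumes "polytime_computable f" "polytime_computable g"
  shows "polytime_computable (\<lambda>x. enc_bool (f x = g x))"
proof -
  have s: "size (left x) \<le> size x" "size (right x) \<le> size x" for x
    by (cases x; auto)+
  have "polytime_computable (\<lambda>x. enc_bool (left x = right x))"
    using s by (intro pt_assign[of "\<lambda>n. 10 + 4 * n" "Eq (Hd (Var 0)) (Tl (Var 0))"]
      poly_bounded_intros) (auto simp: init_state_def numeral_eq_Suc intro!: add_mono le_SucI)
  from pt_compose[OF this pt_Node[OF assms]] show ?thesis by simp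
qed

text \<open>The test is evaluated from register 1 on, which preserves the input. Once the branch is
  chosen the result of the test is dispensable, so both branches run from register 0 on.\<close>

lemma pt_if:
  assumes "polytime_computable a" "polytime_computable b" "polytime_computable f"
    "polytime_computable g"
  shows "polytime_computable (\<lambda>x. if a x = b x then f x else g x)"
proof -
  obtain ca pa where a: "computes 1 ca (\<lambda>x. enc_bool (a x = b x)) pa"
    using polytime_computable_computes[OF pt_eq[OF assms(1,2)]] .
  obtain cf pf where f: "computes 0 cf f pf"
    using polytime_computable_computes[OF assms(3)] .
  obtain cg pg where g: "computes 0 cg g pg"
    using polytime_computable_computes[OF assms(4)] .
  let ?c = "Seq (Assign 1 (Var 0)) (Seq ca (If (Var 1) cf cg))"
  let ?b = "\<lambda>n. 20 + n + poly pa n + poly pf n + poly pg n"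
  show ?thesis
  proof (rule polytime_computableI[of ?b ?c])
    fix x
    let ?s1 = "(init_state x)(1 := eval (Var 0) (init_state x))"
    obtain t2 s2 where 2: "exec ca ?s1 t2 s2" "s2 1 = enc_bool (a x = b x)" "s2 0 = x"
      "t2 \<le> poly pa (size x)"
      using computesE[OF a, of ?s1] by (auto simp: init_state_def)
    show "\<exists>t s. exec ?c (init_state x) t s \<and> s 0 = (if a x = b x then f x else g x) \<and>
      t \<le> ?b (size x)"
    proof (cases "a x = b x")
      case True
      obtain t3 s3 where 3: "exec cf s2 t3 s3" "s3 0 = f x" "t3 \<le> poly pf (size x)"
        using computesE[OF f, of s2] 2 by auto
      have "eval (Var 1) s2 \<noteq> Leaf" using True 2 by simp
      note ex = exec.Seq[OF exec.Assign exec.Seq[OF 2(1) exec.IfTrue[OF this 3(1)]]]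
      show ?thesis
        by (rule exI, rule exI, rule conjI, rule ex) (use 2 3 True in \<open>auto simp: init_state_def\<close>)
    next
      case False
      obtain t3 s3 where 3: "exec cg s2 t3 s3" "s3 0 = g x" "t3 \<le> poly pg (size x)"
        using computesE[OF g, of s2] 2 by auto
      have "eval (Var 1) s2 = Leaf" using False 2 by simp
      note ex = exec.Seq[OF exec.Assign exec.Seq[OF 2(1) exec.IfFalse[OF this 3(1)]]]
      show ?thesis
        by (rule exI, rule exI, rule conjI, rule ex) (use 2 3 False in \<open>auto simp: init_state_def\<close>)
    qed
  qed (intro poly_bounded_intros)
qed

text \<open>The right spine. Together with \<open>enc_list\<close> it makes every tree a list of
  trees, so programs on lists are total and need no check that the input is well-formed.\<close>

fun tlist :: "tree \<Rightarrow> tree list" where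
  "tlist Leaf = []"
| "tlist (Node a b) = a # tlist b"

text \<open>
  Loops over a list are the only source of superpolynomial growth, so the accumulator has to be
  bounded separately.
\<close>

lemma pt_foldl:
  assumes l: "polytime_computable l" and i: "polytime_computable i"
    and g: "polytime_computable (\<lambda>z. g (left z) (left (right z)) (right (right z)))"
    and b: "poly_bounded b"
    and bound: "\<And>x k. size (foldl (\<lambda>acc a. g a x acc) (i x) (take k (tlist (l x)))) \<le> b (size x)"
  shows "polytime_computable (\<lambda>x. foldl (\<lambda>acc a. g a x acc) (i x) (tlist (l x)))"
proof -
  \<comment> \<open>The loop keeps its whole state in register 0: the remaining list, the input
    \<open>x\<close> and the accumulator.\<close>
  define step where "step = (\<lambda>z. Node (right (left z)) (Node (left (right z))
    (g (left (left z)) (left (right z)) (right (right z)))))"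
  have "polytime_computable step"
    unfolding step_def
    using pt_compose[OF g, of "\<lambda>z. Node (left (left z)) (Node (left (right z)) (right (right z)))"]
    by (intro pt_Node pt_left pt_right pt_id) (simp add: pt_Node pt_left pt_right pt_id)
  then obtain c p where c: "computes 0 c step p"
    using polytime_computable_computes by blast
  \<comment> \<open>\<open>B'\<close> bounds the accumulator at every stage and \<open>B\<close> the
    whole loop state, where \<open>2\<close> counts the pairing nodes. The factor
    \<open>5 + 2 * B + poly p B\<close> generously covers one test and one round.\<close>
  have loop: "\<exists>t s'. exec (While (Hd (Var 0)) c) s t s' \<and>
      s' 0 = Node Leaf (Node x (foldl (\<lambda>acc a. g a x acc) acc (tlist y))) \<and>
      t \<le> (1 + size y) * (5 + 2 * B + poly p B)"
    if "s 0 = Node y (Node x acc)" "2 + size y + size x + B' \<le> B"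
      "\<forall>k. size (foldl (\<lambda>acc a. g a x acc) acc (take k (tlist y))) \<le> B'"
    for s y x acc B B'
    using that
  proof (induction y arbitrary: s acc)
    case Leaf
    have "eval (Hd (Var 0)) s = Leaf" using Leaf by simp
    note ex = exec.WhileFalse[OF this, of c]
    have "size acc \<le> B'" using Leaf.prems(3) by simp
    show ?case
      by (rule exI, rule exI, rule conjI, rule ex)
        (use Leaf.prems \<open>size acc \<le> B'\<close> in auto)
  next
    case (Node a y)
    have acc: "size (foldl (\<lambda>acc a. g a x acc) acc (take 0 (tlist (Node a y)))) \<le> B'"
      using Node.prems(3) by blast
    then have B: "size (s 0) \<le> B"
      using Node.prems(1,2) by simp
    have ne: "eval (Hd (Var 0)) s \<noteq> Leaf"
      using Node.prems(1) by simp
    obtain t1 s1 where 1: "exec c s t1 s1" "s1 0 = Node y (Node x (g a x acc))"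
      "t1 \<le> poly p (size (s 0))"
      using computesE[OF c, of s] Node.prems(1) by (auto simp: step_def)
    have t1: "t1 \<le> poly p B"
      using 1(3) poly_nat_mono[OF B] le_trans by blast
    have "\<forall>k. size (foldl (\<lambda>acc a. g a x acc) (g a x acc) (take k (tlist y))) \<le> B'"
    proof
      show "size (foldl (\<lambda>acc a. g a x acc) (g a x acc) (take k (tlist y))) \<le> B'" for k
        using Node.prems(3)[rule_format, of "Suc k"] by simp
    qed
    then obtain t2 s2 where 2: "exec (While (Hd (Var 0)) c) s1 t2 s2"
      "s2 0 = Node Leaf (Node x (foldl (\<lambda>acc a. g a x acc) (g a x acc) (tlist y)))"
      "t2 \<le> (1 + size y) * (5 + 2 * B + poly p B)"
      using Node.IH(2)[of s1 "g a x acc", OF 1(2)] Node.prems(2) by auto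
    have "cost (Hd (Var 0)) s \<le> 2 + 2 * B"
      using Node.prems(1,2) B by simp
    moreover have "(1 + size (Node a y)) * (5 + 2 * B + poly p B) \<ge>
        (5 + 2 * B + poly p B) + (1 + size y) * (5 + 2 * B + poly p B)"
      by (simp add: algebra_simps)
    ultimately have "1 + cost (Hd (Var 0)) s + t1 + t2
        \<le> (1 + size (Node a y)) * (5 + 2 * B + poly p B)"
      using t1 2(3) by linarith
    with exec.WhileTrue[OF ne 1(1) 2(1)] 2(2) show ?case
      unfolding tlist.simps foldl_Cons by blast
  qed
  have "polytime_computable (\<lambda>x. Node (l x) (Node x (i x)))"
    by (intro pt_Node pt_id l i)
  then obtain c0 p0 where c0: "computes 0 c0 (\<lambda>x. Node (l x) (Node x (i x))) p0"
    using polytime_computable_computes by blast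
  obtain q :: "nat poly" where q: "\<And>x. size (l x) \<le> poly q (size x)"
    using polytime_computable_size[OF l] by blast
  let ?B = "\<lambda>n. 2 + poly q n + n + b n"
  let ?T = "\<lambda>n. 1 + poly p0 n + (1 + poly q n) * (5 + 2 * ?B n + poly p (?B n))"
  have "polytime_computable
    (\<lambda>x. Node Leaf (Node x (foldl (\<lambda>acc a. g a x acc) (i x) (tlist (l x)))))"
  proof (rule polytime_computableI[of ?T "Seq c0 (While (Hd (Var 0)) c)"])
    fix x
    obtain t1 s1 where 1: "exec c0 (init_state x) t1 s1" "s1 0 = Node (l x) (Node x (i x))"
      "t1 \<le> poly p0 (size x)"
      using computesE[OF c0, of "init_state x"] by (auto simp: init_state_def)
    have "2 + size (l x) + size x + b (size x) \<le> ?B (size x)"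
      using q[of x] by simp
    from loop[of s1 "l x" x "i x", OF 1(2) this] obtain t2 s2 where 2: "exec (While (Hd (Var 0)) c) s1 t2 s2"
      "s2 0 = Node Leaf (Node x (foldl (\<lambda>acc a. g a x acc) (i x) (tlist (l x))))"
      "t2 \<le> (1 + size (l x)) * (5 + 2 * ?B (size x) + poly p (?B (size x)))"
      using bound by blast
    have "(1 + size (l x)) * (5 + 2 * ?B (size x) + poly p (?B (size x)))
        \<le> (1 + poly q (size x)) * (5 + 2 * ?B (size x) + poly p (?B (size x)))"
      using q[of x] by (intro mult_right_mono) auto
    with 1(3) 2(3) have "1 + t1 + t2 \<le> ?T (size x)"
      by linarith
    with exec.Seq[OF 1(1) 2(1)] 2(2)
    show "\<exists>t s. exec (Seq c0 (While (Hd (Var 0)) c)) (init_state x) t s \<and>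
        s 0 = Node Leaf (Node x (foldl (\<lambda>acc a. g a x acc) (i x) (tlist (l x)))) \<and>
        t \<le> ?T (size x)"
      by blast
  qed (intro poly_bounded_intros b)
  from pt_right[OF pt_right[OF this]] show ?thesis by simp
qed

lemma pt_compose2:
  assumes "polytime_computable (\<lambda>z. F (left z) (right z))"
    and "polytime_computable f" "polytime_computable g"
  shows "polytime_computable (\<lambda>x. F (f x) (g x))"
  using pt_compose[OF assms(1) pt_Node[OF assms(2,3)]] by simp

section \<open>List programs\<close>

lemma tlist_enc_list [simp]: "tlist (enc_list e xs) = map e xs"
  by (induction xs) auto

lemma enc_list_tlist [simp]: "enc_list (\<lambda>x. x) (tlist t) = t"
  by (induction t) auto

lemma enc_list_map: "enc_list e (map f xs) = enc_list (\<lambda>x. e (f x)) xs"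
  by (induction xs) auto

lemma enc_list_cong: "(\<And>x. x \<in> set xs \<Longrightarrow> e x = e' x) \<Longrightarrow> enc_list e xs = enc_list e' xs"
  by (induction xs) auto

lemma enc_list_eq_Leaf [simp]: "enc_list e xs = Leaf \<longleftrightarrow> xs = []"
  by (cases xs) auto

lemma tlist_enc_nat [simp]: "tlist (enc_nat n) = replicate n Leaf"
  by (induction n) auto

lemma size_enc_nat [simp]: "size (enc_nat n) = n"
  by (induction n) auto

lemma length_tlist: "length (tlist t) \<le> size t"
  by (induction t) auto

lemma size_tlist: "a \<in> set (tlist t) \<Longrightarrow> size a < size t"
  by (induction t) auto

section \<open>Reversal, concatenation, mapping and filtering of encoded lists\<close>

definition trevapp :: "tree \<Rightarrow> tree \<Rightarrow> tree" where
  "trevapp a b = foldl (\<lambda>acc x. Node x acc) b (tlist a)"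

lemma foldl_Node: "foldl (\<lambda>acc x. Node x acc) b xs = enc_list (\<lambda>x. x) (rev xs @ tlist b)"
  by (induction xs arbitrary: b) auto

lemma trevapp_eq: "trevapp a b = enc_list (\<lambda>x. x) (rev (tlist a) @ tlist b)"
  by (simp add: trevapp_def foldl_Node)

lemma tlist_trevapp [simp]: "tlist (trevapp a b) = rev (tlist a) @ tlist b"
  by (simp add: trevapp_eq)

text \<open>Each step moves one cell from \<open>a\<close> to the accumulator, so the total size is
  conserved. Prefixes are treated because \<open>pt_foldl\<close> asks for a bound on all
  intermediate values.\<close>

lemma size_trevapp_aux:
  "size (foldl (\<lambda>acc x. Node x acc) b (take k (tlist a))) \<le> size a + size b"
proof (induction a arbitrary: b k)
  case (Node a1 a2)
  show ?case
  proof (cases k)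
    case (Suc k')
    then show ?thesis using Node.IH(2)[of "Node a1 b" k'] by simp
  qed auto
qed auto

lemma size_trevapp: "size (trevapp a b) \<le> size a + size b"
  using size_trevapp_aux[of b "length (tlist a)" a] by (simp add: trevapp_def)

lemma pt_trevapp:
  assumes "polytime_computable f" "polytime_computable g"
  shows "polytime_computable (\<lambda>x. trevapp (f x) (g x))"
proof -
  obtain p :: "nat poly" where p: "\<And>x. size (f x) \<le> poly p (size x)"
    using polytime_computable_size[OF assms(1)] by blast
  obtain q :: "nat poly" where q: "\<And>x. size (g x) \<le> poly q (size x)"
    using polytime_computable_size[OF assms(2)] by blast
  show ?thesis
    unfolding trevapp_def
  proof (rule pt_foldl[where b = "\<lambda>n. poly p n + poly q n"])
    show "size (foldl (\<lambda>acc a. Node a acc) (g x) (take k (tlist (f x))))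
        \<le> poly p (size x) + poly q (size x)" for x k
      using size_trevapp_aux[of "g x" k "f x"] p[of x] q[of x] by linarith
  qed (intro pt_Node pt_left pt_right pt_id poly_bounded_intros assms)+
qed

text \<open>The output is automatically of polynomial size, so that no bound is needed as in \<open>pt_foldl\<close>.\<close>

definition tconcat_map :: "(tree \<Rightarrow> tree) \<Rightarrow> tree \<Rightarrow> tree" where
  "tconcat_map g t = enc_list (\<lambda>x. x) (concat (map (\<lambda>a. tlist (g a)) (tlist t)))"

lemma foldl_trevapp:
  "tlist (foldl (\<lambda>acc a. trevapp (g a) acc) i xs)
    = rev (concat (map (\<lambda>a. tlist (g a)) xs)) @ tlist i"
  by (induction xs arbitrary: i) auto

text \<open>The typical harmless loop: growth by an additive constant per round, as opposed to
  doubling.\<close>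

lemma size_foldl:
  assumes "\<And>acc a. a \<in> set xs \<Longrightarrow> size (f acc a :: tree) \<le> size acc + C"
  shows "size (foldl f i xs) \<le> size i + length xs * C"
  using assms
proof (induction xs arbitrary: i)
  case (Cons a xs)
  have "size (foldl f (f i a) xs) \<le> size (f i a) + length xs * C"
    by (rule Cons.IH) (use Cons.prems in auto)
  with Cons.prems[of a i] show ?case by simp
qed auto

lemma pt_tconcat_map:
  assumes f: "polytime_computable f" and g: "polytime_computable (\<lambda>z. g (left z) (right z))"
  shows "polytime_computable (\<lambda>x. tconcat_map (\<lambda>a. g a x) (f x))"
proof -
  obtain p :: "nat poly" where p: "\<And>x. size (f x) \<le> poly p (size x)"
    using polytime_computable_size[OF f] by blast
  obtain q :: "nat poly" where "\<And>z. size (g (left z) (right z)) \<le> poly q (size z)"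
    using polytime_computable_size[OF g] by blast
  from this[of "Node _ _"] have q: "size (g a x) \<le> poly q (size a + size x + 1)" for a x
    by simp
  \<comment> \<open>A list element is no larger than the list, hence at most
    \<open>poly p n\<close>; the final \<open>1\<close> is the node that pairs it with
    \<open>x\<close>.\<close>
  let ?C = "\<lambda>n. poly q (poly p n + n + 1)"
  have "polytime_computable (\<lambda>x. foldl (\<lambda>acc a. trevapp (g a x) acc) Leaf (tlist (f x)))"
  proof (rule pt_foldl[where b = "\<lambda>n. poly p n * ?C n"])
    show "polytime_computable
      (\<lambda>z. trevapp (g (left z) (left (right z))) (right (right z)))"
      by (intro pt_trevapp pt_compose2[OF g] pt_left pt_right pt_id)
    fix x k
    have "size (g a x) \<le> ?C (size x)" if "a \<in> set (take k (tlist (f x)))" for a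
    proof -
      have "size a \<le> poly p (size x)"
        using size_tlist[of a "f x"] p[of x] set_take_subset[of k "tlist (f x)"] that by force
      then have "size a + size x + 1 \<le> poly p (size x) + size x + 1"
        by simp
      then show ?thesis
        using q[of a x] poly_nat_mono le_trans by blast
    qed
    then have "size (foldl (\<lambda>acc a. trevapp (g a x) acc) Leaf (take k (tlist (f x))))
        \<le> size Leaf + length (take k (tlist (f x))) * ?C (size x)"
      by (intro size_foldl order.trans[OF size_trevapp]) (simp add: add.commute)
    also have "\<dots> \<le> poly p (size x) * ?C (size x)"
      using length_tlist[of "f x"] p[of x] by (auto intro!: mult_right_mono)
    finally show "size (foldl (\<lambda>acc a. trevapp (g a x) acc) Leaf (take k (tlist (f x))))
        \<le> poly p (size x) * ?C (size x)" .
  qed (intro f pt_const poly_bounded_intros)+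
  \<comment> \<open>The fold accumulates the output backwards; one more \<open>trevapp\<close> onto
    the empty list restores the order.\<close>
  moreover have "tconcat_map (\<lambda>a. g a x) (f x)
      = trevapp (foldl (\<lambda>acc a. trevapp (g a x) acc) Leaf (tlist (f x))) Leaf" for x
    by (subst trevapp_eq) (simp add: foldl_trevapp tconcat_map_def)
  ultimately show ?thesis
    by (simp add: pt_trevapp pt_const)
qed

lemma tconcat_map_enc:
  assumes "\<And>a. a \<in> set xs \<Longrightarrow> g (e a) = enc_list e' (h a)"
  shows "tconcat_map g (enc_list e xs) = enc_list e' (concat (map h xs))"
proof -
  have "concat (map (\<lambda>a. tlist (g (e a))) xs) = concat (map (\<lambda>a. map e' (h a)) xs)"
    using assms by (intro arg_cong[where f = concat] map_cong) auto
  also have "\<dots> = map e' (concat (map h xs))"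
    by (simp add: map_concat comp_def)
  finally show ?thesis
    by (simp add: tconcat_map_def comp_def enc_list_map)
qed

definition tconcat :: "tree \<Rightarrow> tree" where
  "tconcat = tconcat_map (\<lambda>a. a)"

lemma pt_tconcat: "polytime_computable f \<Longrightarrow> polytime_computable (\<lambda>x. tconcat (f x))"
  unfolding tconcat_def by (intro pt_tconcat_map pt_left pt_id)

lemma tconcat_enc:
  assumes "\<And>a. a \<in> set xs \<Longrightarrow> f a = enc_list e (h a)"
  shows "tconcat (enc_list f xs) = enc_list e (concat (map h xs))"
proof -
  have "enc_list f xs = enc_list (\<lambda>x. enc_list e x) (map h xs)"
    using assms by (auto simp: enc_list_map intro: enc_list_cong)
  then show ?thesis
    unfolding tconcat_def by (simp add: tconcat_map_enc[where h = "\<lambda>x. x"])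
qed

definition tmap :: "(tree \<Rightarrow> tree) \<Rightarrow> tree \<Rightarrow> tree" where
  "tmap g = tconcat_map (\<lambda>a. Node (g a) Leaf)"

lemma pt_tmap:
  assumes "polytime_computable f" "polytime_computable (\<lambda>z. g (left z) (right z))"
  shows "polytime_computable (\<lambda>x. tmap (\<lambda>a. g a x) (f x))"
  unfolding tmap_def by (intro pt_tconcat_map pt_Node pt_const assms)

lemma tmap_enc:
  assumes "\<And>a. a \<in> set xs \<Longrightarrow> g (e a) = e' (h a)"
  shows "tmap g (enc_list e xs) = enc_list e' (map h xs)"
  using tconcat_map_enc[of xs "\<lambda>a. Node (g a) Leaf" e e' "\<lambda>a. [h a]"] assms
  by (simp add: tmap_def)

definition tfilter :: "(tree \<Rightarrow> tree) \<Rightarrow> tree \<Rightarrow> tree" where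
  "tfilter g = tconcat_map (\<lambda>a. if g a = Leaf then Leaf else Node a Leaf)"

lemma pt_tfilter:
  assumes "polytime_computable f" "polytime_computable (\<lambda>z. g (left z) (right z))"
  shows "polytime_computable (\<lambda>x. tfilter (\<lambda>a. g a x) (f x))"
  unfolding tfilter_def by (intro pt_tconcat_map pt_if pt_Node pt_const pt_left pt_id assms)

lemma tfilter_enc:
  assumes "\<And>a. a \<in> set xs \<Longrightarrow> (g (e a) \<noteq> Leaf) = P a"
  shows "tfilter g (enc_list e xs) = enc_list e (filter P xs)"
proof -
  have "tfilter g (enc_list e xs) = enc_list e (concat (map (\<lambda>a. if P a then [a] else []) xs))"
    unfolding tfilter_def by (rule tconcat_map_enc) (use assms in auto)
  also have "concat (map (\<lambda>a. if P a then [a] else []) xs) = filter P xs"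
    by (induction xs) auto
  finally show ?thesis .
qed

text \<open>Holds for every \<open>g\<close>. For \<open>tgreedy\<close> this bounds the chosen
  value without any knowledge of the answers of \<open>U\<close>.\<close>

lemma size_left_tfilter: "size (left (tfilter g t)) \<le> size t"
proof (induction t)
  case (Node a t)
  have "tfilter g (Node a t) = (if g a = Leaf then tfilter g t else Node a (tfilter g t))"
    by (simp add: tfilter_def tconcat_map_def)
  then show ?case using Node.IH(2) by auto
qed (simp add: tfilter_def tconcat_map_def)

definition tappend :: "tree \<Rightarrow> tree \<Rightarrow> tree" where
  "tappend a b = trevapp (trevapp a Leaf) b"

lemma pt_tappend:
  "polytime_computable f \<Longrightarrow> polytime_computable g \<Longrightarrow>
    polytime_computable (\<lambda>x. tappend (f x) (g x))"
  unfolding tappend_def by (intro pt_trevapp pt_const)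

lemma tappend_enc: "tappend (enc_list e xs) (enc_list e ys) = enc_list e (xs @ ys)"
  by (simp add: tappend_def trevapp_eq flip: enc_list_map[of "\<lambda>x. x" e, simplified])

text \<open>Here \<open>cs\<close> belongs to the program and not to the input: the code is unrolled
  once for each operation symbol, variable or identity of \<open>M\<close>.\<close>

lemma pt_enc_list:
  assumes "\<And>c. c \<in> set cs \<Longrightarrow> polytime_computable (f c)"
  shows "polytime_computable (\<lambda>x. enc_list (\<lambda>c. f c x) cs)"
  using assms by (induction cs) (auto intro!: pt_const pt_Node)

text \<open>The accumulator is the descending list of the numbers so far, so the next number is the
  successor of its head. A final reversal makes the list ascending.\<close>

definition tupto :: "tree \<Rightarrow> tree" where
  "tupto t = trevapp (foldl (\<lambda>acc a. Node (if acc = Leaf then Leaf else Node Leaf (left acc)) acc)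
     Leaf (tlist t)) Leaf"

lemma foldl_tupto:
  "foldl (\<lambda>acc a. Node (if acc = Leaf then Leaf else Node Leaf (left acc)) acc) Leaf xs
    = enc_list enc_nat (rev [0..<length xs])"
proof (induction xs rule: rev_induct)
  case (snoc x xs)
  then show ?case by (cases "length xs") auto
qed auto

lemma tupto_enc [simp]: "tupto (enc_nat n) = enc_list enc_nat [0..<n]"
  by (simp add: tupto_def foldl_tupto trevapp_eq rev_map flip: enc_list_map[of "\<lambda>x. x" enc_nat, simplified])

text \<open>Unary numerals make the list quadratic rather than linear in its length.\<close>

lemma size_enc_list_nat: "size (enc_list enc_nat (rev [0..<k])) \<le> k * k"
  by (induction k) auto

lemma pt_tupto:
  assumes "polytime_computable f"
  shows "polytime_computable (\<lambda>x. tupto (f x))"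
proof -
  obtain p :: "nat poly" where p: "\<And>x. size (f x) \<le> poly p (size x)"
    using polytime_computable_size[OF assms(1)] by blast
  show ?thesis
    unfolding tupto_def
  proof (intro pt_trevapp, rule pt_foldl[where b = "\<lambda>n. poly p n * poly p n"])
    fix x k
    let ?k = "length (take k (tlist (f x)))"
    have "?k \<le> poly p (size x)"
      using length_tlist[of "f x"] p[of x] by simp
    then have "?k * ?k \<le> poly p (size x) * poly p (size x)"
      by (intro mult_mono) auto
    then show "size (foldl (\<lambda>acc a. Node (if acc = Leaf then Leaf else Node Leaf (left acc)) acc)
        Leaf (take k (tlist (f x)))) \<le> poly p (size x) * poly p (size x)"
      unfolding foldl_tupto using size_enc_list_nat le_trans by blast
  qed (intro assms pt_const pt_if pt_Node pt_left pt_right pt_id poly_bounded_intros)+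
qed

definition tnth :: "tree \<Rightarrow> tree \<Rightarrow> tree" where
  "tnth l j = left (foldl (\<lambda>acc a. right acc) l (tlist j))"

lemma tnth_enc: "j < length xs \<Longrightarrow> tnth (enc_list e xs) (enc_nat j) = e (xs ! j)"
proof (induction j arbitrary: xs)
  case 0
  then show ?case by (cases xs) (auto simp: tnth_def)
next
  case (Suc j)
  then show ?case by (cases xs) (auto simp: tnth_def)
qed

lemma pt_tnth:
  assumes "polytime_computable f" "polytime_computable g"
  shows "polytime_computable (\<lambda>x. tnth (f x) (g x))"
proof -
  obtain p :: "nat poly" where p: "\<And>x. size (f x) \<le> poly p (size x)"
    using polytime_computable_size[OF assms(1)] by blast
  have s: "size (foldl (\<lambda>acc (a :: tree). right acc) l xs) \<le> size l" for l xs
  proof (induction xs arbitrary: l)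
    case (Cons x xs)
    have "size (right l) \<le> size l" by (cases l) auto
    with Cons[of "right l"] show ?case by simp
  qed auto
  show ?thesis
    unfolding tnth_def
  proof (intro pt_left, rule pt_foldl[where b = "poly p"])
    show "size (foldl (\<lambda>acc a. right acc) (f x) (take k (tlist (g x)))) \<le> poly p (size x)" for x k
      using s p le_trans by blast
  qed (intro assms pt_right pt_id poly_bounded_intros)+
qed

text \<open>The recursion on \<open>k\<close> takes place in the logic, giving one program for each
  \<open>k\<close>. The degree of its running time may depend on \<open>k\<close>, which is an arity
  or the variable bound of \<open>M\<close>. The order of enumeration follows
  \<open>List.n_lists\<close>, as the tables require.\<close>

fun tnlists :: "nat \<Rightarrow> tree \<Rightarrow> tree" where
  "tnlists 0 t = Node Leaf Leaf"
| "tnlists (Suc k) t = tconcat_map (\<lambda>ys. tmap (\<lambda>y. Node y ys) t) (tnlists k t)"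

lemma pt_tnlists:
  assumes "polytime_computable f"
  shows "polytime_computable (\<lambda>x. tnlists k (f x))"
proof (rule pt_compose[OF _ assms])
  show "polytime_computable (tnlists k)"
    by (induction k) (auto intro!: pt_const pt_tconcat_map pt_tmap pt_Node pt_left pt_right pt_id)
qed

lemma tnlists_enc: "tnlists k (enc_list e xs) = enc_list (enc_list e) (List.n_lists k xs)"
proof (induction k)
  case (Suc k)
  have "tmap (\<lambda>y. Node y (enc_list e ys)) (enc_list e xs)
      = enc_list (enc_list e) (map (\<lambda>y. y # ys) xs)" for ys
    by (rule tmap_enc) simp
  then show ?case
    by (simp add: Suc tconcat_map_enc[where h = "\<lambda>ys. map (\<lambda>y. y # ys) xs" and e' = "enc_list e"])
qed simp

text \<open>The counter restarts at every match, so it ends as the number of entries after the last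
  occurrence. A single left fold thus finds a position, counted from the end.\<close>

definition tindex :: "tree \<Rightarrow> tree \<Rightarrow> tree" where
  "tindex l a = foldl (\<lambda>acc b. if b = a then Leaf else Node Leaf acc) Leaf (tlist l)"

lemma foldl_tindex:
  "foldl (\<lambda>acc b. if b = a then Leaf else Node Leaf acc) Leaf xs
    = enc_nat (length (takeWhile (\<lambda>b. b \<noteq> a) (rev xs)))"
  by (induction xs rule: rev_induct) auto

lemma pt_tindex:
  assumes "polytime_computable f" "polytime_computable g"
  shows "polytime_computable (\<lambda>x. tindex (f x) (g x))"
proof (rule pt_compose2[OF _ assms])
  show "polytime_computable (\<lambda>z. tindex (left z) (right z))"
    unfolding tindex_def
  proof (rule pt_foldl[where b = "\<lambda>n. n"])
    fix z k
    have "length (takeWhile (\<lambda>b. b \<noteq> right z) (rev (take k (tlist (left z))))) \<le> length (tlist (left z))"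
      by (rule order.trans[OF length_takeWhile_le]) simp
    also have "\<dots> \<le> size z"
      using length_tlist[of "left z"] by (cases z) auto
    finally show "size (foldl (\<lambda>acc b. if b = right z then Leaf else Node Leaf acc) Leaf
        (take k (tlist (left z)))) \<le> size z"
      by (simp add: foldl_tindex)
  qed (intro pt_const pt_if pt_Node pt_left pt_right pt_id poly_bounded_intros)+
qed

definition tlookup :: "tree \<Rightarrow> tree \<Rightarrow> tree" where
  "tlookup k t = right (left (tfilter (\<lambda>p. enc_bool (left p = k)) t))"

lemma pt_tlookup:
  assumes "polytime_computable f" "polytime_computable g"
  shows "polytime_computable (\<lambda>x. tlookup (f x) (g x))"
proof (rule pt_compose2[OF _ assms])
  show "polytime_computable (\<lambda>z. tlookup (left z) (right z))"
    unfolding tlookup_def by (intro pt_tfilter pt_eq pt_left pt_right pt_id)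
qed

lemmas pt_intros =
  pt_id pt_const pt_Node pt_left pt_right pt_eq pt_if pt_tconcat_map pt_tconcat pt_tmap pt_tfilter
  pt_tappend pt_enc_list pt_tupto pt_tnth pt_tnlists pt_tindex pt_tlookup

section \<open>The indicator instance\<close>

text \<open>
  The key \<open>(i, a)\<close> stands for the unknown value of the operation \<open>i\<close> at the argument tuple \<open>a\<close>.
  A block \<open>(r, ts, kts)\<close> is an \<open>r\<close>-ary relation with tuples \<open>ts\<close> together with the tuples of keys
  whose values are required to belong to it.
\<close>

type_synonym key = "nat \<times> nat list"
type_synonym block = "nat \<times> nat list list \<times> key list list"

definition keys :: "maltsev_condition \<Rightarrow> rel_structure \<Rightarrow> key list" where
  "keys M H = concat (map (\<lambda>i. map (\<lambda>a. (i, a)) (List.n_lists (op_arities M ! i) [0..<univ_size H]))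
     [0..<length (op_arities M)])"

text \<open>One tuple of keys for each symbol and each choice of its arguments from
  \<open>ts\<close>; requiring the tuple of values to lie in \<open>ts\<close> is the polymorphism
  condition.\<close>

definition rel_keys :: "maltsev_condition \<Rightarrow> nat \<Rightarrow> nat list list \<Rightarrow> key list list" where
  "rel_keys M r ts = concat (map (\<lambda>i. map (\<lambda>us. map (\<lambda>j. (i, map (\<lambda>u. u ! j) us)) [0..<r])
     (List.n_lists (op_arities M ! i) ts)) [0..<length (op_arities M)])"

definition satisfied :: "(key \<Rightarrow> nat) \<Rightarrow> block list \<Rightarrow> bool" where
  "satisfied \<phi> bs \<longleftrightarrow> (\<forall>(r, ts, kts) \<in> set bs. \<forall>kt \<in> set kts. map \<phi> kt \<in> set ts)"

definition valid :: "maltsev_condition \<Rightarrow> rel_structure \<Rightarrow> (key \<Rightarrow> nat) \<Rightarrow> bool" where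
  "valid M H \<phi> \<longleftrightarrow> (\<forall>k \<in> set (keys M H). \<phi> k < univ_size H)"

text \<open>Positions refer to the reversed list because this is what the fold \<open>tindex\<close>
  computes.\<close>

definition key_index :: "maltsev_condition \<Rightarrow> rel_structure \<Rightarrow> key \<Rightarrow> nat" where
  "key_index M H k = length (takeWhile (\<lambda>k'. k' \<noteq> k) (rev (keys M H)))"

definition ops :: "maltsev_condition \<Rightarrow> (key \<Rightarrow> nat) \<Rightarrow> (nat list \<Rightarrow> nat) list" where
  "ops M \<phi> = map (\<lambda>i a. \<phi> (i, a)) [0..<length (op_arities M)]"

text \<open>The default 0 agrees with \<open>tlookup\<close>, which yields \<open>Leaf\<close>, the
  code of 0, if no pair matches.\<close>

definition lookup :: "('k \<times> nat) list \<Rightarrow> 'k \<Rightarrow> nat" where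
  "lookup asg k = (case filter (\<lambda>p. fst p = k) asg of [] \<Rightarrow> 0 | p # _ \<Rightarrow> snd p)"

fun vars_ident :: "ident \<Rightarrow> nat set" where
  "vars_ident (Id_op i xs j ys) = set xs \<union> set ys"
| "vars_ident (Id_var i xs y) = insert y (set xs)"

lemma finite_vars_ident: "finite (vars_ident e)"
  by (cases e) auto

lemma set_keys:
  "set (keys M H) = {(i, a). i < length (op_arities M) \<and> length a = op_arities M ! i \<and>
    set a \<subseteq> universe H}"
  by (auto simp: keys_def set_n_lists universe_def)

lemma set_rel_keys:
  "set (rel_keys M r ts) = {map (\<lambda>j. (i, map (\<lambda>u. u ! j) us)) [0..<r] | i us.
    i < length (op_arities M) \<and> length us = op_arities M ! i \<and> set us \<subseteq> set ts}"
  unfolding rel_keys_def by (simp add: set_n_lists atLeast0LessThan) blast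

lemma is_structureD:
  assumes "is_structure H" "(r, ts) \<in> set (rels H)"
  shows "r \<ge> 1" "u \<in> set ts \<Longrightarrow> length u = r \<and> set u \<subseteq> universe H"
  using assms unfolding is_structure_def by fast+

text \<open>Gives \<open>key_index\<close> an inverse on the keys, so that maps on indices and maps
  on keys can be exchanged.\<close>

lemma key_index_less:
  assumes "k \<in> set (keys M H)"
  shows "key_index M H k < length (keys M H)"
    and "rev (keys M H) ! key_index M H k = k"
proof -
  have "key_index M H k < length (rev (keys M H))"
  proof -
    have "takeWhile (\<lambda>k'. k' \<noteq> k) (rev (keys M H)) \<noteq> rev (keys M H)"
      using assms by (auto simp: takeWhile_eq_all_conv)
    then show ?thesis
      unfolding key_index_def
      by (metis length_takeWhile_le le_neq_implies_less order_refl take_all takeWhile_eq_take)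
  qed
  moreover from this show "rev (keys M H) ! key_index M H k = k"
    unfolding key_index_def using nth_length_takeWhile by blast
  ultimately show "key_index M H k < length (keys M H)"
    by simp
qed

lemma lookup_in:
  assumes "k \<in> fst ` set asg"
  shows "(k, lookup asg k) \<in> set asg"
proof -
  obtain p ps where "filter (\<lambda>p. fst p = k) asg = p # ps"
    using assms by (cases "filter (\<lambda>p. fst p = k) asg") (auto simp: filter_empty_conv)
  moreover from this have "p \<in> set asg" "fst p = k"
    by (auto simp: filter_eq_Cons_iff)
  ultimately show ?thesis by (auto simp: lookup_def)
qed

lemma length_ops [simp]: "length (ops M \<phi>) = length (op_arities M)"
  by (simp add: ops_def)

lemma nth_ops [simp]: "i < length (op_arities M) \<Longrightarrow> (ops M \<phi> ! i) a = \<phi> (i, a)"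
  by (simp add: ops_def)

lemma ops_id: "length fs = length (op_arities M) \<Longrightarrow> ops M (\<lambda>(i, a). (fs ! i) a) = fs"
  by (intro nth_equalityI) (auto simp: ops_def)

lemma valid_iff_interprets: "valid M H \<phi> \<longleftrightarrow> interprets (universe H) (ops M \<phi>) M"
  by (auto simp: valid_def set_keys interprets_def operation_on_def universe_def)

text \<open>\<open>K\<close> bounds the variables, so that lists of length \<open>K\<close> serve as valuations.\<close>

locale indicator =
  fixes M :: maltsev_condition and es :: "ident list" and K :: nat
  assumes strong: "strong_linear_maltsev M"
    and set_es: "set es = idents M"
    and K: "e \<in> idents M \<Longrightarrow> vars_ident e \<subseteq> {..<K}"
begin

definition vals :: "rel_structure \<Rightarrow> nat list list" where
  "vals H = List.n_lists K [0..<univ_size H]"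

fun id_op_keys :: "rel_structure \<Rightarrow> ident \<Rightarrow> key list list" where
  "id_op_keys H (Id_op i xs j ys) = map (\<lambda>l. [(i, map ((!) l) xs), (j, map ((!) l) ys)]) (vals H)"
| "id_op_keys H (Id_var i xs y) = []"

text \<open>An identity \<open>f(xs) \<approx> y\<close> prescribes table entries outright, so it is
  handled by the same singletons as the choices of the search.\<close>

fun id_var_pins :: "rel_structure \<Rightarrow> ident \<Rightarrow> (key \<times> nat) list" where
  "id_var_pins H (Id_op i xs j ys) = []"
| "id_var_pins H (Id_var i xs y) = map (\<lambda>l. ((i, map ((!) l) xs), l ! y)) (vals H)"

definition id_pins :: "rel_structure \<Rightarrow> (key \<times> nat) list" where
  "id_pins H = concat (map (id_var_pins H) es)"

text \<open>The unary relation \<open>{a}\<close> on the right, and on the left the keys pinned to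
  \<open>a\<close>. The block is present even if no key is pinned to \<open>a\<close>.\<close>

definition pin_block :: "(key \<times> nat) list \<Rightarrow> nat \<Rightarrow> block" where
  "pin_block pins a = (1, [[a]], map (\<lambda>p. [fst p]) (filter (\<lambda>p. snd p = a) pins))"

definition blocks :: "rel_structure \<Rightarrow> (key \<times> nat) list \<Rightarrow> block list" where
  "blocks H pins = map (\<lambda>(r, ts). (r, ts, rel_keys M r ts)) (rels H) @
     (2, map (\<lambda>a. [a, a]) [0..<univ_size H], concat (map (id_op_keys H) es)) #
     map (pin_block (pins @ id_pins H)) [0..<univ_size H]"

text \<open>Keys have indices below \<open>length (keys M H)\<close>. The one surplus element keeps
  the universe nonempty even if \<open>M\<close> has no operation symbols.\<close>

definition indicator :: "rel_structure \<Rightarrow> (key \<times> nat) list \<Rightarrow> rel_structure" where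
  "indicator H pins = \<lparr>univ_size = Suc (length (keys M H)),
     rels = map (\<lambda>(r, ts, kts). (r, map (map (key_index M H)) kts)) (blocks H pins)\<rparr>"

definition expansion :: "rel_structure \<Rightarrow> rel_structure" where
  "expansion H = \<lparr>univ_size = univ_size H, rels = map (\<lambda>(r, ts, kts). (r, ts)) (blocks H [])\<rparr>"

section \<open>Well-formedness of the indicator instance\<close>

lemma set_vals: "set (vals H) = {l. length l = K \<and> set l \<subseteq> universe H}"
  by (auto simp: vals_def set_n_lists universe_def)

lemma map_val:
  assumes "l \<in> set (vals H)" "set xs \<subseteq> {..<K}"
  shows "set (map ((!) l) xs) \<subseteq> universe H"
  using assms by (force simp: set_vals)

lemma wf: "e \<in> idents M \<Longrightarrow> wf_ident (op_arities M) e"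
  using strong by (auto simp: strong_linear_maltsev_def)

lemma id_op_keys_in_keys:
  assumes "e \<in> idents M" "kt \<in> set (id_op_keys H e)"
  shows "set kt \<subseteq> set (keys M H) \<and> length kt = 2"
proof (cases e)
  case (Id_op i xs j ys)
  then obtain l where l: "l \<in> set (vals H)" "kt = [(i, map ((!) l) xs), (j, map ((!) l) ys)]"
    using assms(2) by auto
  show ?thesis
    using wf[OF assms(1)] K[OF assms(1)] map_val[OF l(1)]
    by (simp add: Id_op l(2) set_keys del: set_map)
qed (use assms(2) in auto)

lemma id_pins_in_keys:
  assumes "(k, b) \<in> set (id_pins H)"
  shows "k \<in> set (keys M H)"
proof -
  obtain e where e: "e \<in> idents M" "(k, b) \<in> set (id_var_pins H e)"
    using assms by (auto simp: id_pins_def set_es)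
  show ?thesis
  proof (cases e)
    case (Id_var i xs y)
    then obtain l where l: "l \<in> set (vals H)" "k = (i, map ((!) l) xs)"
      using e(2) by auto
    show ?thesis
      using wf[OF e(1)] K[OF e(1)] map_val[OF l(1)]
      by (simp add: Id_var l(2) set_keys del: set_map)
  qed (use e(2) in auto)
qed

lemma rel_keys_in_keys:
  assumes "is_structure H" "(r, ts) \<in> set (rels H)" "kt \<in> set (rel_keys M r ts)"
  shows "set kt \<subseteq> set (keys M H)" "length kt = r"
proof -
  obtain i us where kt: "kt = map (\<lambda>j. (i, map (\<lambda>u. u ! j) us)) [0..<r]"
    "i < length (op_arities M)" "length us = op_arities M ! i" "set us \<subseteq> set ts"
    using assms(3) by (auto simp: set_rel_keys)
  have "u ! j \<in> universe H" if "u \<in> set us" "j < r" for u j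
  proof -
    have "length u = r" "set u \<subseteq> universe H"
      using is_structureD(2)[OF assms(1,2)] kt(4) that(1) by auto
    then show ?thesis using that(2) by auto
  qed
  with kt show "set kt \<subseteq> set (keys M H)" "length kt = r"
    by (auto simp: set_keys)
qed

lemma blocks_cases:
  assumes "(r, ts, kts) \<in> set (blocks H pins)"
  obtains (rel) "(r, ts) \<in> set (rels H)" "kts = rel_keys M r ts"
  | (eq) "r = 2" "ts = map (\<lambda>a. [a, a]) [0..<univ_size H]" "kts = concat (map (id_op_keys H) es)"
  | (pin) a where "a < univ_size H" "r = 1" "ts = [[a]]"
      "kts = map (\<lambda>p. [fst p]) (filter (\<lambda>p. snd p = a) (pins @ id_pins H))"
  using assms unfolding blocks_def pin_block_def by auto

lemma blocks_in_keys:
  assumes "is_structure H" "fst ` set pins \<subseteq> set (keys M H)" "(r, ts, kts) \<in> set (blocks H pins)"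
    "kt \<in> set kts"
  shows "set kt \<subseteq> set (keys M H) \<and> length kt = r"
  using assms(3)
proof (cases rule: blocks_cases)
  case rel
  then show ?thesis using rel_keys_in_keys[OF assms(1) rel(1)] assms(4) by blast
next
  case eq
  then obtain e where "e \<in> idents M" "kt \<in> set (id_op_keys H e)"
    using assms(4) by (auto simp: set_es)
  then show ?thesis using id_op_keys_in_keys eq(1) by blast
next
  case (pin a)
  then obtain p where p: "kt = [fst p]" "p \<in> set pins \<union> set (id_pins H)"
    using assms(4) unfolding pin(4) set_map set_filter set_append by blast
  then show ?thesis using assms(2) id_pins_in_keys[of "fst p" "snd p"] pin(2) by auto
qed

lemma blocks_arity:
  assumes "is_structure H" "(r, ts, kts) \<in> set (blocks H pins)"
  shows "r \<ge> 1" "u \<in> set ts \<Longrightarrow> length u = r \<and> set u \<subseteq> universe H"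
  using is_structureD[OF assms(1)]
  by (cases rule: blocks_cases[OF assms(2)]; auto simp: universe_def)+

text \<open>Only the tuples of keys depend on \<open>pins\<close>. Hence all queries share the
  template \<open>expansion H\<close>, and the promise has to be established for it alone.\<close>

lemma map_fst_blocks:
  "map (\<lambda>(r, ts, kts). (r, ts)) (blocks H pins) = map (\<lambda>(r, ts, kts). (r, ts)) (blocks H [])"
  by (simp add: blocks_def pin_block_def comp_def)

lemma csp_instance_indicator:
  assumes "is_structure H" "fst ` set pins \<subseteq> set (keys M H)"
  shows "csp_instance (indicator H pins) (expansion H)"
proof -
  have "is_structure (indicator H pins)"
    unfolding is_structure_def
  proof (intro conjI ballI, simp_all only: split_paired_all prod.case)
    fix r us assume "(r, us) \<in> set (rels (indicator H pins))"
    then obtain ts kts where b: "(r, ts, kts) \<in> set (blocks H pins)"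
      and us: "us = map (map (key_index M H)) kts"
      by (auto simp: indicator_def)
    have "length u = r \<and> set u \<subseteq> universe (indicator H pins)" if u: "u \<in> set us" for u
    proof -
      obtain kt where kt: "kt \<in> set kts" "u = map (key_index M H) kt"
        using u us by auto
      have "key_index M H k < Suc (length (keys M H))" if "k \<in> set kt" for k
        using blocks_in_keys[OF assms b kt(1)] that by (intro less_SucI key_index_less(1)) blast
      then show ?thesis
        using blocks_in_keys[OF assms b kt(1)]
        by (auto simp: kt(2) universe_def indicator_def)
    qed
    then show "1 \<le> r \<and> (\<forall>u \<in> set us. length u = r \<and> set u \<subseteq> universe (indicator H pins))"
      using blocks_arity(1)[OF assms(1) b] by blast
  qed (auto simp: universe_def indicator_def)
  moreover have "is_structure (expansion H)"
    unfolding is_structure_def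
  proof (intro conjI ballI, simp_all only: split_paired_all prod.case)
    fix r ts assume "(r, ts) \<in> set (rels (expansion H))"
    then obtain kts where b: "(r, ts, kts) \<in> set (blocks H [])"
      by (auto simp: expansion_def)
    show "1 \<le> r \<and> (\<forall>u \<in> set ts. length u = r \<and> set u \<subseteq> universe (expansion H))"
      using blocks_arity[OF assms(1) b] by (auto simp: universe_def expansion_def)
  qed (use assms(1) in \<open>auto simp: universe_def expansion_def is_structure_def\<close>)
  moreover have "map fst (rels (indicator H pins)) = map fst (rels (expansion H))"
  proof -
    have "map fst (rels (indicator H pins)) = map fst (map (\<lambda>(r, ts, kts). (r, ts)) (blocks H pins))"
      by (simp add: indicator_def comp_def case_prod_beta)
    then show ?thesis
      unfolding map_fst_blocks[of H pins] by (simp add: expansion_def)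
  qed
  ultimately show ?thesis by (simp add: csp_instance_def)
qed

section \<open>Solutions of the indicator instance\<close>

lemma satisfied_nth:
  "satisfied \<phi> bs \<longleftrightarrow> (\<forall>i < length bs. \<forall>kt \<in> set (snd (snd (bs ! i))). map \<phi> kt \<in> set (fst (snd (bs ! i))))"
  by (auto simp: satisfied_def all_set_conv_all_nth case_prod_beta)

text \<open>Constraints mention only genuine keys, on which \<open>key_index\<close> is invertible.
  A homomorphism composed with \<open>key_index\<close> is a solution, and a solution composed with
  the inverse is a homomorphism.\<close>

lemma yes_instance_indicator:
  assumes "is_structure H" "fst ` set pins \<subseteq> set (keys M H)"
  shows "yes_instance (indicator H pins) (expansion H) \<longleftrightarrow>
    (\<exists>\<phi>. valid M H \<phi> \<and> satisfied \<phi> (blocks H pins))"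
proof -
  have rels: "snd (rels (indicator H pins) ! i) = map (map (key_index M H)) (snd (snd (blocks H pins ! i)))"
    "snd (rels (expansion H) ! i) = fst (snd (blocks H pins ! i))"
    if "i < length (blocks H pins)" for i
  proof -
    show "snd (rels (indicator H pins) ! i) = map (map (key_index M H)) (snd (snd (blocks H pins ! i)))"
      using that by (simp add: indicator_def case_prod_beta)
    have "rels (expansion H) = map (\<lambda>(r, ts, kts). (r, ts)) (blocks H pins)"
      by (simp add: expansion_def map_fst_blocks[of H pins])
    then show "snd (rels (expansion H) ! i) = fst (snd (blocks H pins ! i))"
      using that by (simp add: case_prod_beta)
  qed
  have len: "length (rels (indicator H pins)) = length (blocks H pins)"
    by (simp add: indicator_def)
  show ?thesis
  proof
    assume "yes_instance (indicator H pins) (expansion H)"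
    then obtain h where h: "homomorphism h (indicator H pins) (expansion H)"
      by (auto simp: yes_instance_def)
    have "valid M H (\<lambda>k. h (key_index M H k))"
      unfolding valid_def
    proof
      fix k assume "k \<in> set (keys M H)"
      from key_index_less(1)[OF this] have "key_index M H k \<in> universe (indicator H pins)"
        by (simp add: universe_def indicator_def)
      then have "h (key_index M H k) \<in> universe (expansion H)"
        using h by (auto simp: homomorphism_def)
      then show "h (key_index M H k) < univ_size H"
        by (simp add: universe_def expansion_def)
    qed
    moreover have "satisfied (\<lambda>k. h (key_index M H k)) (blocks H pins)"
      using h by (auto simp: satisfied_nth homomorphism_def rels len comp_def)
    ultimately show "\<exists>\<phi>. valid M H \<phi> \<and> satisfied \<phi> (blocks H pins)" by blast
  next
    assume "\<exists>\<phi>. valid M H \<phi> \<and> satisfied \<phi> (blocks H pins)"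
    then obtain \<phi> where \<phi>: "valid M H \<phi>" "satisfied \<phi> (blocks H pins)" by blast
    \<comment> \<open>The surplus element occurs in no constraint; it is sent to 0, which belongs to
      every nonempty universe.\<close>
    define h where "h j = (if j < length (keys M H) then \<phi> (rev (keys M H) ! j) else 0)" for j
    have h_index: "h (key_index M H k) = \<phi> k" if "k \<in> set (keys M H)" for k
      using key_index_less[OF that] by (simp add: h_def)
    have "h j < univ_size H" for j
    proof -
      have "rev (keys M H) ! j \<in> set (keys M H)" if "j < length (keys M H)"
        using that by (metis length_rev nth_mem set_rev)
      then show ?thesis
        using \<phi>(1) assms(1) by (auto simp: h_def valid_def is_structure_def universe_def)
    qed
    moreover have "map h (map (key_index M H) kt) \<in> set (fst (snd (blocks H pins ! i)))"
      if i: "i < length (blocks H pins)" "kt \<in> set (snd (snd (blocks H pins ! i)))" for i kt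
    proof -
      have "(fst (blocks H pins ! i), fst (snd (blocks H pins ! i)), snd (snd (blocks H pins ! i)))
          \<in> set (blocks H pins)"
        using i(1) by simp
      from blocks_in_keys[OF assms this i(2)] have eq: "map h (map (key_index M H) kt) = map \<phi> kt"
        using h_index by auto
      show ?thesis unfolding eq using \<phi>(2) i by (simp add: satisfied_nth)
    qed
    ultimately have "homomorphism h (indicator H pins) (expansion H)"
      by (auto simp: homomorphism_def rels len) (auto simp: universe_def expansion_def)
    then show "yes_instance (indicator H pins) (expansion H)"
      by (auto simp: yes_instance_def)
  qed
qed

text \<open>All variables of the identity lie below \<open>K\<close>, so finitely many valuations,
  given as lists, represent all of them.\<close>

lemma ident_holds_vals:
  assumes "e \<in> idents M" "is_structure H"
  shows "(\<forall>v. range v \<subseteq> universe H \<longrightarrow> ident_holds fs v e) \<longleftrightarrow>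
    (\<forall>l \<in> set (vals H). ident_holds fs ((!) l) e)"
proof -
  have cong: "ident_holds fs v e = ident_holds fs w e" if "\<forall>x < K. v x = w x" for v w :: "nat \<Rightarrow> nat"
  proof -
    have "\<forall>x \<in> vars_ident e. v x = w x" using that K[OF assms(1)] by auto
    then show ?thesis by (cases e) (auto simp: map_eq_conv cong: map_cong)
  qed
  show ?thesis
  proof safe
    fix l assume H: "\<forall>v. range v \<subseteq> universe H \<longrightarrow> ident_holds fs v e" and l: "l \<in> set (vals H)"
    \<comment> \<open>Beyond \<open>K\<close> the value \<open>l ! x\<close> is unspecified and
      might leave the universe, so it is replaced by 0.\<close>
    let ?v = "\<lambda>x. if x < K then l ! x else 0"
    have "0 \<in> universe H" using assms(2) by (auto simp: is_structure_def universe_def)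
    then have "range ?v \<subseteq> universe H"
      using l by (auto simp: set_vals)
    then have "ident_holds fs ?v e" using H by blast
    then show "ident_holds fs ((!) l) e" using cong[of ?v "(!) l"] by simp
  next
    fix v :: "nat \<Rightarrow> nat" assume H: "\<forall>l \<in> set (vals H). ident_holds fs ((!) l) e" and v: "range v \<subseteq> universe H"
    have "map v [0..<K] \<in> set (vals H)" using v by (auto simp: set_vals)
    then have "ident_holds fs ((!) (map v [0..<K])) e" using H by blast
    then show "ident_holds fs v e" using cong[of "(!) (map v [0..<K])" v] by simp
  qed
qed

text \<open>Blocks from \<open>rels H\<close> express the polymorphism condition; the equality block
  and the pins from \<open>id_pins\<close> express the identities. The guard
  \<open>b < univ_size H\<close> appears because a pin with a larger value falls into no singleton
  block.\<close>

lemma satisfied_blocks: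
  assumes "is_structure H" "valid M H \<phi>"
  shows "satisfied \<phi> (blocks H pins) \<longleftrightarrow> satisfying_polymorphisms H (ops M \<phi>) M \<and>
    (\<forall>(k, b) \<in> set pins. b < univ_size H \<longrightarrow> \<phi> k = b)"
proof -
  let ?pinned = "\<lambda>pins. \<forall>(k, b) \<in> set pins. b < univ_size H \<longrightarrow> \<phi> k = b"
  have rels: "(\<forall>(r, ts) \<in> set (rels H). \<forall>kt \<in> set (rel_keys M r ts). map \<phi> kt \<in> set ts) \<longleftrightarrow>
    (\<forall>i < length (op_arities M). polymorphism H (op_arities M ! i) (ops M \<phi> ! i))"
    (is "?L \<longleftrightarrow> ?R")
  proof -
    have rel_keys: "(\<forall>kt \<in> set (rel_keys M r ts). map \<phi> kt \<in> set ts) \<longleftrightarrow>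
        (\<forall>i < length (op_arities M). \<forall>us. length us = op_arities M ! i \<and> set us \<subseteq> set ts \<longrightarrow>
          map (\<lambda>j. \<phi> (i, map (\<lambda>u. u ! j) us)) [0..<r] \<in> set ts)" for r ts
    proof -
      have "(\<forall>kt \<in> set (rel_keys M r ts). map \<phi> kt \<in> set ts) \<longleftrightarrow>
        (\<forall>i < length (op_arities M). \<forall>us. length us = op_arities M ! i \<and> set us \<subseteq> set ts \<longrightarrow>
          map \<phi> (map (\<lambda>j. (i, map (\<lambda>u. u ! j) us)) [0..<r]) \<in> set ts)"
        unfolding set_rel_keys by blast
      then show ?thesis by (simp add: comp_def)
    qed
    have "?R \<longleftrightarrow> (\<forall>i < length (op_arities M). \<forall>(r, ts) \<in> set (rels H). \<forall>us.
        length us = op_arities M ! i \<and> set us \<subseteq> set ts \<longrightarrow>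
        map (\<lambda>j. \<phi> (i, map (\<lambda>u. u ! j) us)) [0..<r] \<in> set ts)"
      using assms(2) by (auto simp: polymorphism_def valid_iff_interprets interprets_def)
    also have "\<dots> \<longleftrightarrow> ?L"
      unfolding rel_keys case_prod_beta by blast
    finally show ?thesis by blast
  qed
  have id_ops: "(\<forall>kt \<in> set (id_op_keys H e). map \<phi> kt \<in> set (map (\<lambda>a. [a, a]) [0..<univ_size H]))
      \<and> ?pinned (id_var_pins H e) \<longleftrightarrow> (\<forall>l \<in> set (vals H). ident_holds (ops M \<phi>) ((!) l) e)"
    if e: "e \<in> idents M" for e
  proof (cases e)
    case (Id_op i xs j ys)
    \<comment> \<open>The equality block also confines the common value to the universe, which
      \<open>valid\<close> already guarantees.\<close>
    have "\<phi> (i, map ((!) l) xs) < univ_size H" if "l \<in> set (vals H)" for l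
      using id_op_keys_in_keys(1)[OF e, of "[(i, map ((!) l) xs), (j, map ((!) l) ys)]" H] that
        assms(2) by (auto simp: Id_op valid_def)
    then show ?thesis
      using wf[OF e] by (auto simp: Id_op)
  next
    case (Id_var i xs y)
    \<comment> \<open>This discharges the range guard in \<open>?pinned\<close> for the pins that
      stem from identities.\<close>
    have "l ! y < univ_size H" if "l \<in> set (vals H)" for l
      using map_val[OF that, of "[y]"] K[OF e] by (simp add: Id_var universe_def)
    then show ?thesis
      using wf[OF e] by (auto simp: Id_var)
  qed
  have "satisfied \<phi> (map (pin_block ps) [0..<univ_size H]) \<longleftrightarrow> ?pinned ps" for ps
    by (auto simp: satisfied_def pin_block_def)
  then have "satisfied \<phi> (blocks H pins) \<longleftrightarrow>
      (\<forall>(r, ts) \<in> set (rels H). \<forall>kt \<in> set (rel_keys M r ts). map \<phi> kt \<in> set ts) \<and>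
      (\<forall>e \<in> idents M. (\<forall>kt \<in> set (id_op_keys H e).
        map \<phi> kt \<in> set (map (\<lambda>a. [a, a]) [0..<univ_size H])) \<and> ?pinned (id_var_pins H e)) \<and>
      ?pinned pins"
    unfolding blocks_def by (auto simp: satisfied_def id_pins_def set_es ball_Un)
  also have "\<dots> \<longleftrightarrow> satisfying_polymorphisms H (ops M \<phi>) M \<and> ?pinned pins"
    using assms(2) ident_holds_vals[OF _ assms(1)] id_ops unfolding rels
    by (auto simp: satisfying_polymorphisms_def algebra_satisfies_def valid_iff_interprets)
  finally show ?thesis .
qed

lemma satisfies_iff:
  assumes "is_structure H"
  shows "satisfies H M \<longleftrightarrow> (\<exists>\<phi>. valid M H \<phi> \<and> satisfied \<phi> (blocks H []))"
proof
  assume "satisfies H M"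
  then obtain fs where fs: "satisfying_polymorphisms H fs M"
    by (auto simp: satisfies_def)
  then have *: "interprets (universe H) fs M"
    by (auto simp: satisfying_polymorphisms_def algebra_satisfies_def)
  then have "ops M (\<lambda>(i, a). (fs ! i) a) = fs"
    by (intro ops_id) (simp add: interprets_def)
  with fs * have "valid M H (\<lambda>(i, a). (fs ! i) a)" "satisfied (\<lambda>(i, a). (fs ! i) a) (blocks H [])"
    by (simp_all add: valid_iff_interprets satisfied_blocks[OF assms])
  then show "\<exists>\<phi>. valid M H \<phi> \<and> satisfied \<phi> (blocks H [])" by blast
next
  assume "\<exists>\<phi>. valid M H \<phi> \<and> satisfied \<phi> (blocks H [])"
  then show "satisfies H M"
    by (auto simp: satisfies_def satisfied_blocks[OF assms])
qed

text \<open>Idempotent operations preserve the singletons, hence also the additional relations.\<close>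

lemma satisfies_expansion:
  assumes "idempotent M" "is_structure H" "satisfies H M"
  shows "satisfies (expansion H) M"
proof -
  obtain fs where fs: "satisfying_polymorphisms H fs M"
    using assms(3) by (auto simp: satisfies_def)
  have univ: "universe (expansion H) = universe H"
    by (simp add: universe_def expansion_def)
  have alg: "algebra_satisfies (universe H) fs M" "universe H \<noteq> {}"
    using fs assms(2) by (auto simp: satisfying_polymorphisms_def is_structure_def)
  have "polymorphism (expansion H) (op_arities M ! i) (fs ! i)" if i: "i < length (op_arities M)" for i
  proof -
    let ?k = "op_arities M ! i" and ?f = "fs ! i"
    have pol: "polymorphism H ?k ?f" and op: "operation_on (universe H) ?k ?f"
      using fs i by (auto simp: satisfying_polymorphisms_def polymorphism_def)
    have idem: "?f (replicate ?k a) = a" if "a \<in> universe H" for a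
      using assms(1) alg i that by (auto simp: idempotent_def)
    have diag: "map (\<lambda>j. ?f (map (\<lambda>u. u ! j) us)) [0..<2] \<in> set (map (\<lambda>a. [a, a]) [0..<univ_size H])"
      if us: "length us = ?k" "set us \<subseteq> set (map (\<lambda>a. [a, a]) [0..<univ_size H])" for us
    proof -
      \<comment> \<open>Arguments from the diagonal have the same first and second coordinates, so
        the operation yields the same value twice.\<close>
      have "map (\<lambda>u. u ! 1) us = map (\<lambda>u. u ! 0) us"
        using us(2) by auto
      then have eq: "map (\<lambda>j. ?f (map (\<lambda>u. u ! j) us)) [0, 1]
          = [?f (map (\<lambda>u. u ! 0) us), ?f (map (\<lambda>u. u ! 0) us)]"
        by (simp only: list.map)
      have "set (map (\<lambda>u. u ! 0) us) \<subseteq> universe H"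
        using us(2) by (auto simp: universe_def)
      then have "?f (map (\<lambda>u. u ! 0) us) \<in> universe H"
        using us(1) op unfolding operation_on_def by simp
      moreover have "[0..<2] = [0, 1::nat]"
        by (simp add: upt_conv_Cons)
      ultimately show ?thesis
        by (simp only: eq) (simp add: universe_def)
    qed
    have singleton: "map (\<lambda>j. ?f (map (\<lambda>u. u ! j) us)) [0..<1] \<in> set [[a]]"
      if us: "length us = ?k" "set us \<subseteq> set [[a]]" "a < univ_size H" for us a
    proof -
      \<comment> \<open>Arguments from a singleton relation are constant; this is where idempotence
        enters.\<close>
      have "us = replicate ?k [a]"
        using us(1,2) by (metis empty_set list.simps(15) replicate_eqI singletonD subsetD)
      then have "map (\<lambda>u. u ! 0) us = replicate ?k a"
        by (metis map_replicate nth_Cons_0)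
      then show ?thesis
        using idem[of a] us(3) by (simp add: universe_def)
    qed
    have "map (\<lambda>j. ?f (map (\<lambda>u. u ! j) us)) [0..<r] \<in> set ts"
      if b: "(r, ts, kts) \<in> set (blocks H [])" and us: "length us = ?k" "set us \<subseteq> set ts" for r ts kts us
      using b
    proof (cases rule: blocks_cases)
      case rel
      then show ?thesis using pol us unfolding polymorphism_def by fast
    next
      case eq
      then show ?thesis using diag us by simp
    next
      case (pin a)
      then show ?thesis using singleton us by simp
    qed
    with op show ?thesis
      unfolding polymorphism_def univ by (auto simp: expansion_def)
  qed
  with alg have "satisfying_polymorphisms (expansion H) fs M"
    by (simp add: satisfying_polymorphisms_def univ)
  then show ?thesis by (auto simp: satisfies_def)
qed

end

section \<open>Self-reduction\<close>

fun enc_key :: "key \<Rightarrow> tree" where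
  "enc_key (i, a) = Node (enc_nat i) (enc_list enc_nat a)"

fun enc_pin :: "key \<times> nat \<Rightarrow> tree" where
  "enc_pin (k, b) = Node (enc_key k) (enc_nat b)"

fun enc_block :: "block \<Rightarrow> tree" where
  "enc_block (r, ts, kts) =
    Node (enc_nat r) (Node (enc_list (enc_list enc_nat) ts) (enc_list (enc_list enc_key) kts))"

lemma enc_nat_inject [simp]: "enc_nat m = enc_nat n \<longleftrightarrow> m = n"
  by (metis size_enc_nat)

lemma enc_list_nat_inject [simp]: "enc_list enc_nat xs = enc_list enc_nat ys \<longleftrightarrow> xs = ys"
proof (induction xs arbitrary: ys)
  case Nil
  show ?case by (cases ys) auto
next
  case (Cons x xs)
  then show ?case by (cases ys) auto
qed

lemma enc_key_inject [simp]: "enc_key k = enc_key k' \<longleftrightarrow> k = k'"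
  by (cases k; cases k') auto

lemma enc_bool_eq_Leaf [simp]: "enc_bool b = Leaf \<longleftrightarrow> \<not> b"
  by (cases b) auto

lemma enc_list_Leaf: "enc_list (\<lambda>_. Leaf) xs = enc_nat (length xs)"
  by (induction xs) auto

lemma left_enc_pin [simp]: "left (enc_pin p) = enc_key (fst p)"
  and right_enc_pin [simp]: "right (enc_pin p) = enc_nat (snd p)"
  by (cases p; simp)+

lemma tlookup_enc: "tlookup (enc_key k) (enc_list enc_pin asg) = enc_nat (lookup asg k)"
proof -
  have "tfilter (\<lambda>p. enc_bool (left p = enc_key k)) (enc_list enc_pin asg)
      = enc_list enc_pin (filter (\<lambda>p. fst p = k) asg)"
    by (rule tfilter_enc) simp
  then show ?thesis
    by (simp add: tlookup_def lookup_def split: list.split)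
qed

lemma left_enc_structure [simp]: "left (enc_structure H) = enc_nat (univ_size H)"
  and right_enc_structure [simp]: "right (enc_structure H) = enc_list enc_rel (rels H)"
  by (simp_all add: enc_structure_def)

section \<open>Correctness of the greedy search\<close>

locale creation = indicator +
  fixes U :: "tree \<Rightarrow> tree"
  assumes pt_U: "polytime_computable U"
    and U: "csp_instance G H \<Longrightarrow> satisfies H M \<Longrightarrow>
      U (Node (enc_structure G) (enc_structure H)) = enc_bool (yes_instance G H)"
    and idem: "idempotent M"
begin

text \<open>Outside the promise \<open>U\<close> may return any tree. Reading every tree other than
  \<open>Leaf\<close> as yes keeps the search well-defined and agrees with
  \<open>tfilter\<close>.\<close>

definition query :: "rel_structure \<Rightarrow> (key \<times> nat) list \<Rightarrow> bool" where
  "query H pins \<longleftrightarrow>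
    U (Node (enc_structure (indicator H pins)) (enc_structure (expansion H))) \<noteq> Leaf"

text \<open>If every candidate is rejected, the default 0 still lies in the universe, so the
  resulting tables describe operations whatever \<open>U\<close> answers. It also equals the head
  that \<open>left\<close> returns for an empty filtered list.\<close>

definition pick :: "rel_structure \<Rightarrow> (key \<times> nat) list \<Rightarrow> key \<Rightarrow> nat" where
  "pick H asg k =
    (case filter (\<lambda>a. query H ((k, a) # asg)) [0..<univ_size H] of [] \<Rightarrow> 0 | a # _ \<Rightarrow> a)"

definition extend :: "rel_structure \<Rightarrow> (key \<times> nat) list \<Rightarrow> key \<Rightarrow> (key \<times> nat) list" where
  "extend H asg k = (k, pick H asg k) # asg"

definition greedy :: "rel_structure \<Rightarrow> (key \<times> nat) list" where
  "greedy H = foldl (extend H) [] (keys M H)"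

lemma pick_cases:
  obtains "pick H asg k < univ_size H" "query H ((k, pick H asg k) # asg)"
  | "pick H asg k = 0" "\<And>a. a < univ_size H \<Longrightarrow> \<not> query H ((k, a) # asg)"
proof (cases "filter (\<lambda>a. query H ((k, a) # asg)) [0..<univ_size H]")
  case Nil
  then show ?thesis using that(2) by (auto simp: pick_def filter_empty_conv)
next
  case (Cons a as)
  then have "a \<in> set (filter (\<lambda>a. query H ((k, a) # asg)) [0..<univ_size H])"
    by simp
  then have "a < univ_size H" "query H ((k, a) # asg)"
    by auto
  then show ?thesis using that(1) Cons by (simp add: pick_def)
qed

text \<open>The only place where the answers of \<open>U\<close> are trusted:
  \<open>satisfies H M\<close> passes on to \<open>expansion H\<close> by idempotence.\<close>

lemma query_iff:
  assumes "is_structure H" "satisfies H M" "fst ` set pins \<subseteq> set (keys M H)"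
  shows "query H pins \<longleftrightarrow> (\<exists>\<phi>. valid M H \<phi> \<and> satisfied \<phi> (blocks H pins))"
  using U[OF csp_instance_indicator satisfies_expansion[OF idem]] assms
  by (simp add: query_def yes_instance_indicator)

lemma fst_foldl_extend: "fst ` set (foldl (extend H) asg ks) = fst ` set asg \<union> set ks"
  by (induction ks arbitrary: asg) (auto simp: extend_def)

lemma snd_foldl_extend:
  assumes "is_structure H" "snd ` set asg \<subseteq> universe H"
  shows "snd ` set (foldl (extend H) asg ks) \<subseteq> universe H"
  using assms(2)
proof (induction ks arbitrary: asg)
  case (Cons k ks)
  have "0 < univ_size H" using assms(1) by (auto simp: is_structure_def universe_def)
  then have "pick H asg k \<in> universe H"
    by (cases rule: pick_cases[of H asg k]) (auto simp: universe_def)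
  then have "snd ` set (extend H asg k) \<subseteq> universe H"
    using Cons.prems by (simp add: extend_def)
  then show ?case using Cons.IH by simp
qed simp

text \<open>The search invariant. The value at \<open>k\<close> of a current solution is an
  acceptable candidate, so \<open>pick\<close> does not fall back on its default; the candidate
  actually picked may belong to a different solution, which \<open>query_iff\<close>
  provides.\<close>

lemma foldl_extend_satisfiable:
  assumes H: "is_structure H" "satisfies H M"
    and "fst ` set asg \<subseteq> set (keys M H)" "set ks \<subseteq> set (keys M H)"
    and "\<exists>\<phi>. valid M H \<phi> \<and> satisfied \<phi> (blocks H asg)"
  shows "\<exists>\<phi>. valid M H \<phi> \<and> satisfied \<phi> (blocks H (foldl (extend H) asg ks))"
  using assms(3-)
proof (induction ks arbitrary: asg)
  case (Cons k ks)
  then obtain \<phi> where \<phi>: "valid M H \<phi>" "satisfied \<phi> (blocks H asg)" by blast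
  have pins: "fst ` set ((k, a) # asg) \<subseteq> set (keys M H)" for a
    using Cons.prems by auto
  have "\<phi> k < univ_size H"
    using \<phi>(1) Cons.prems(2) by (auto simp: valid_def)
  moreover have "satisfied \<phi> (blocks H ((k, \<phi> k) # asg))"
    using \<phi> by (auto simp: satisfied_blocks[OF H(1)])
  then have "query H ((k, \<phi> k) # asg)"
    unfolding query_iff[OF H pins] using \<phi>(1) by blast
  ultimately have "query H (extend H asg k)"
    unfolding extend_def by (cases rule: pick_cases[of H asg k]) auto
  then have "\<exists>\<phi>. valid M H \<phi> \<and> satisfied \<phi> (blocks H (extend H asg k))"
    unfolding extend_def query_iff[OF H pins] .
  then show ?case
    using Cons.IH[of "extend H asg k"] Cons.prems pins by (simp add: extend_def)
qed simp

lemma satisfied_cong: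
  assumes "is_structure H" "fst ` set pins \<subseteq> set (keys M H)"
    and "\<And>k. k \<in> set (keys M H) \<Longrightarrow> \<phi> k = \<psi> k" "satisfied \<phi> (blocks H pins)"
  shows "satisfied \<psi> (blocks H pins)"
  unfolding satisfied_def
proof (intro ballI, simp only: split_paired_all prod.case, intro ballI)
  fix r ts kts kt
  assume b: "(r, ts, kts) \<in> set (blocks H pins)" "kt \<in> set kts"
  have "map \<psi> kt = map \<phi> kt"
    using blocks_in_keys[OF assms(1,2) b] assms(3) by (intro map_cong refl) (metis subsetD)
  moreover have "map \<phi> kt \<in> set ts"
    using assms(4) b by (auto simp: satisfied_def simp del: set_map)
  ultimately show "map \<psi> kt \<in> set ts"
    by (simp only:)
qed

text \<open>The second part makes the final check a decision procedure for
  \<open>satisfies H M\<close>: one direction is the search invariant, and for the other the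
  assignment that passes is itself a witness.\<close>

lemma lookup_greedy:
  assumes "is_structure H"
  shows "valid M H (lookup (greedy H))"
    and "satisfied (lookup (greedy H)) (blocks H []) \<longleftrightarrow> satisfies H M"
proof -
  have in_greedy: "(k, lookup (greedy H) k) \<in> set (greedy H)" if "k \<in> set (keys M H)" for k
    using that by (intro lookup_in) (simp add: greedy_def fst_foldl_extend)
  have snd_greedy: "snd ` set (greedy H) \<subseteq> universe H"
    unfolding greedy_def by (rule snd_foldl_extend[OF assms]) simp
  show valid: "valid M H (lookup (greedy H))"
    unfolding valid_def using in_greedy snd_greedy by (force simp: universe_def)
  show "satisfied (lookup (greedy H)) (blocks H []) \<longleftrightarrow> satisfies H M"
  proof
    assume sat: "satisfies H M"
    then have "\<exists>\<phi>. valid M H \<phi> \<and> satisfied \<phi> (blocks H (greedy H))"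
      unfolding greedy_def using assms
      by (intro foldl_extend_satisfiable) (simp_all add: satisfies_iff)
    then obtain \<phi> where \<phi>: "valid M H \<phi>" "satisfied \<phi> (blocks H (greedy H))" by blast
    \<comment> \<open>At the end every key is pinned to an element of the universe, so a solution
      that respects the pins is determined on all keys.\<close>
    have "\<phi> k = lookup (greedy H) k" if k: "k \<in> set (keys M H)" for k
      using \<phi> in_greedy[OF k] valid k unfolding satisfied_blocks[OF assms \<phi>(1)] valid_def by auto
    with satisfied_cong[OF assms, of "[]" \<phi> "lookup (greedy H)"]
    show "satisfied (lookup (greedy H)) (blocks H [])"
      using \<phi> by (simp add: satisfied_blocks[OF assms])
  next
    assume "satisfied (lookup (greedy H)) (blocks H [])"
    then show "satisfies H M"
      unfolding satisfies_iff[OF assms] using valid by blast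
  qed
qed

section \<open>The creation algorithm on trees\<close>

definition tkeys :: "tree \<Rightarrow> tree" where
  "tkeys x = tconcat (enc_list (\<lambda>i. tmap (\<lambda>a. Node (enc_nat i) a)
     (tnlists (op_arities M ! i) (tupto (left x)))) [0..<length (op_arities M)])"

definition trel_keys :: "tree \<Rightarrow> tree" where
  "trel_keys R = tconcat (enc_list (\<lambda>i. tmap (\<lambda>us. tmap (\<lambda>j. Node (enc_nat i)
     (tmap (\<lambda>u. tnth u j) us)) (tupto (left R))) (tnlists (op_arities M ! i) (right R)))
     [0..<length (op_arities M)])"

definition tkey :: "nat \<Rightarrow> nat list \<Rightarrow> tree \<Rightarrow> tree" where
  "tkey i xs l = Node (enc_nat i) (enc_list (\<lambda>x. tnth l (enc_nat x)) xs)"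

definition tvals :: "tree \<Rightarrow> tree" where
  "tvals x = tnlists K (tupto (left x))"

definition tid_op_keys :: "ident \<Rightarrow> tree \<Rightarrow> tree" where
  "tid_op_keys e x = (case e of
     Id_op i xs j ys \<Rightarrow> tmap (\<lambda>l. Node (tkey i xs l) (Node (tkey j ys l) Leaf)) (tvals x)
   | Id_var i xs y \<Rightarrow> Leaf)"

definition tid_var_pins :: "ident \<Rightarrow> tree \<Rightarrow> tree" where
  "tid_var_pins e x = (case e of
     Id_op i xs j ys \<Rightarrow> Leaf
   | Id_var i xs y \<Rightarrow> tmap (\<lambda>l. Node (tkey i xs l) (tnth l (enc_nat y))) (tvals x))"

definition tpin_block :: "tree \<Rightarrow> tree \<Rightarrow> tree" where
  "tpin_block pins a = Node (enc_nat 1) (Node (Node (Node a Leaf) Leaf)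
     (tmap (\<lambda>p. Node (left p) Leaf) (tfilter (\<lambda>p. enc_bool (right p = a)) pins)))"

definition tblocks :: "tree \<Rightarrow> tree \<Rightarrow> tree" where
  "tblocks x pins = tappend
     (tmap (\<lambda>R. Node (left R) (Node (right R) (trel_keys R))) (right x))
     (Node (Node (enc_nat 2) (Node (tmap (\<lambda>a. Node a (Node a Leaf)) (tupto (left x)))
       (tconcat (enc_list (\<lambda>e. tid_op_keys e x) es))))
     (tmap (\<lambda>a. tpin_block (tappend pins (tconcat (enc_list (\<lambda>e. tid_var_pins e x) es))) a)
       (tupto (left x))))"

text \<open>A list of \<open>Leaf\<close>s is a unary numeral, so replacing every key by
  \<open>Leaf\<close> counts the keys; the extra \<open>Node Leaf\<close> is the successor.\<close>

definition tindicator :: "tree \<Rightarrow> tree \<Rightarrow> tree" where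
  "tindicator x pins = Node (Node Leaf (tmap (\<lambda>k. Leaf) (tkeys x)))
     (tmap (\<lambda>b. Node (left b) (tmap (\<lambda>kt. tmap (\<lambda>k. tindex (tkeys x) k) kt) (right (right b))))
       (tblocks x pins))"

definition texpansion :: "tree \<Rightarrow> tree" where
  "texpansion x = Node (left x) (tmap (\<lambda>b. Node (left b) (left (right b))) (tblocks x Leaf))"

definition tpick :: "tree \<Rightarrow> tree \<Rightarrow> tree \<Rightarrow> tree" where
  "tpick x asg k = left (tfilter
     (\<lambda>a. U (Node (tindicator x (Node (Node k a) asg)) (texpansion x))) (tupto (left x)))"

definition tgreedy :: "tree \<Rightarrow> tree" where
  "tgreedy x = foldl (\<lambda>asg k. Node (Node k (tpick x asg k)) asg) Leaf (tlist (tkeys x))"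

text \<open>Collecting the violated constraints turns both universal quantifiers of
  \<open>satisfied\<close> into a single emptiness test.\<close>

definition tviolated :: "tree \<Rightarrow> tree \<Rightarrow> tree" where
  "tviolated x asg = tconcat_map (\<lambda>b. tfilter
     (\<lambda>kt. if tfilter (\<lambda>u. enc_bool (u = tmap (\<lambda>k. tlookup k asg) kt)) (left (right b)) = Leaf
       then Node Leaf Leaf else Leaf)
     (right (right b))) (tblocks x Leaf)"

definition ttables :: "tree \<Rightarrow> tree \<Rightarrow> tree" where
  "ttables x asg = enc_list (\<lambda>i. tmap (\<lambda>a. Node a (tlookup (Node (enc_nat i) a) asg))
     (tnlists (op_arities M ! i) (tupto (left x)))) [0..<length (op_arities M)]"

definition tcreate :: "tree \<Rightarrow> tree" where
  "tcreate x =
    (if tviolated x (tgreedy x) = Leaf then Node (ttables x (tgreedy x)) Leaf else Leaf)"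

section \<open>Running time of the creation algorithm\<close>

lemma pt_tkeys: "polytime_computable f \<Longrightarrow> polytime_computable (\<lambda>x. tkeys (f x))"
  by (erule pt_compose[rotated]) (unfold tkeys_def, intro pt_intros)

lemma pt_trel_keys: "polytime_computable f \<Longrightarrow> polytime_computable (\<lambda>x. trel_keys (f x))"
  by (erule pt_compose[rotated]) (unfold trel_keys_def, intro pt_intros)

lemma pt_tkey: "polytime_computable f \<Longrightarrow> polytime_computable (\<lambda>x. tkey i xs (f x))"
  by (erule pt_compose[rotated]) (unfold tkey_def, intro pt_intros)

lemma pt_tvals: "polytime_computable tvals"
  unfolding tvals_def by (intro pt_intros)

lemma pt_tid_op_keys: "polytime_computable f \<Longrightarrow> polytime_computable (\<lambda>x. tid_op_keys e (f x))"
proof (erule pt_compose[rotated])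
  show "polytime_computable (tid_op_keys e)"
    unfolding tid_op_keys_def by (cases e) (auto intro!: pt_intros pt_tkey pt_tvals)
qed

lemma pt_tid_var_pins: "polytime_computable f \<Longrightarrow> polytime_computable (\<lambda>x. tid_var_pins e (f x))"
proof (erule pt_compose[rotated])
  show "polytime_computable (tid_var_pins e)"
    unfolding tid_var_pins_def by (cases e) (auto intro!: pt_intros pt_tkey pt_tvals)
qed

lemma pt_tpin_block:
  assumes "polytime_computable f" "polytime_computable g"
  shows "polytime_computable (\<lambda>x. tpin_block (f x) (g x))"
  by (rule pt_compose2[OF _ assms]) (unfold tpin_block_def, intro pt_intros)

lemma pt_tblocks:
  assumes "polytime_computable f" "polytime_computable g"
  shows "polytime_computable (\<lambda>x. tblocks (f x) (g x))"
  by (rule pt_compose2[OF _ assms])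
    (unfold tblocks_def, intro pt_intros pt_trel_keys pt_tid_op_keys pt_tid_var_pins pt_tpin_block)

lemma pt_tindicator:
  assumes "polytime_computable f" "polytime_computable g"
  shows "polytime_computable (\<lambda>x. tindicator (f x) (g x))"
  by (rule pt_compose2[OF _ assms]) (unfold tindicator_def, intro pt_intros pt_tkeys pt_tblocks)

lemma pt_texpansion: "polytime_computable f \<Longrightarrow> polytime_computable (\<lambda>x. texpansion (f x))"
  by (erule pt_compose[rotated]) (unfold texpansion_def, intro pt_intros pt_tblocks)

text \<open>Answers of \<open>U\<close> only steer the choice among the elements and are never
  stored, so each round adds one key and one element to the accumulator.\<close>

lemma pt_tgreedy: "polytime_computable tgreedy"
proof -
  obtain p :: "nat poly" where p: "\<And>x. size (tkeys x) \<le> poly p (size x)"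
    using polytime_computable_size[OF pt_tkeys[OF pt_id]] by blast
  have "polytime_computable (\<lambda>x. tupto (left x))"
    by (intro pt_intros)
  then obtain q :: "nat poly" where q: "\<And>x. size (tupto (left x)) \<le> poly q (size x)"
    using polytime_computable_size by blast
  \<comment> \<open>The \<open>2\<close> counts the nodes that pair the key with its value and cons
    the pair onto the list.\<close>
  let ?C = "\<lambda>n. 2 + poly p n + poly q n"
  show ?thesis
    unfolding tgreedy_def
  proof (rule pt_foldl[where b = "\<lambda>n. poly p n * ?C n"])
    show "polytime_computable (\<lambda>z. Node (Node (left z)
      (tpick (left (right z)) (right (right z)) (left z))) (right (right z)))"
      unfolding tpick_def
      by (intro pt_intros pt_compose[OF pt_U] pt_tindicator pt_texpansion)
    fix x k
    let ?f = "\<lambda>asg k. Node (Node k (tpick x asg k)) asg"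
    have "size (?f asg k) \<le> size asg + ?C (size x)" if "k \<in> set (tlist (tkeys x))" for asg k
    proof -
      have "size (tpick x asg k) \<le> poly q (size x)"
        unfolding tpick_def using size_left_tfilter q le_trans by blast
      then show ?thesis
        using size_tlist[OF that] p[of x] by simp
    qed
    then have "size (foldl ?f Leaf (take k (tlist (tkeys x))))
        \<le> size Leaf + length (take k (tlist (tkeys x))) * ?C (size x)"
      by (intro size_foldl) (auto dest: in_set_takeD)
    also have "\<dots> \<le> poly p (size x) * ?C (size x)"
    proof -
      have "length (take k (tlist (tkeys x))) \<le> poly p (size x)"
        using length_tlist[of "tkeys x"] p[of x] by simp
      then have "length (take k (tlist (tkeys x))) * ?C (size x) \<le> poly p (size x) * ?C (size x)"
        by (rule mult_right_mono) simp
      then show ?thesis by simp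
    qed
    finally show "size (foldl ?f Leaf (take k (tlist (tkeys x)))) \<le> poly p (size x) * ?C (size x)" .
  qed (intro pt_intros pt_tkeys poly_bounded_intros)+
qed

lemma pt_tcreate: "polytime_computable tcreate"
  unfolding tcreate_def tviolated_def ttables_def
  by (intro pt_intros pt_tblocks pt_compose[OF pt_tgreedy])

section \<open>Correctness of the creation algorithm on encodings\<close>

lemma tkeys_enc: "tkeys (enc_structure H) = enc_list enc_key (keys M H)"
  unfolding tkeys_def keys_def
  by (rule tconcat_enc, simp add: tnlists_enc, rule tmap_enc, simp)

lemma trel_keys_enc:
  assumes "\<And>u. u \<in> set ts \<Longrightarrow> length u = r"
  shows "trel_keys (Node (enc_nat r) (enc_list (enc_list enc_nat) ts))
    = enc_list (enc_list enc_key) (rel_keys M r ts)"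
  unfolding trel_keys_def rel_keys_def left.simps right.simps tnlists_enc tupto_enc
proof (intro tconcat_enc tmap_enc)
  fix i us j
  assume us: "us \<in> set (List.n_lists (op_arities M ! i) ts)" and j: "j \<in> set [0..<r]"
  have "tmap (\<lambda>u. tnth u (enc_nat j)) (enc_list (enc_list enc_nat) us)
      = enc_list enc_nat (map (\<lambda>u. u ! j) us)"
    using us j assms by (intro tmap_enc tnth_enc) (auto simp: set_n_lists)
  then show "Node (enc_nat i) (tmap (\<lambda>u. tnth u (enc_nat j)) (enc_list (enc_list enc_nat) us))
      = enc_key (i, map (\<lambda>u. u ! j) us)"
    by simp
qed

lemma tvals_enc: "tvals (enc_structure H) = enc_list (enc_list enc_nat) (vals H)"
  by (simp add: tvals_def vals_def tnlists_enc)

lemma tkey_enc: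
  assumes "l \<in> set (vals H)" "set xs \<subseteq> {..<K}"
  shows "tkey i xs (enc_list enc_nat l) = enc_key (i, map ((!) l) xs)"
  using assms by (auto simp: tkey_def set_vals enc_list_map tnth_enc intro!: enc_list_cong)

lemma tid_op_keys_enc:
  assumes "e \<in> idents M"
  shows "tid_op_keys e (enc_structure H) = enc_list (enc_list enc_key) (id_op_keys H e)"
proof (cases e)
  case (Id_op i xs j ys)
  show ?thesis
    unfolding Id_op tid_op_keys_def ident.case id_op_keys.simps tvals_enc
    using K[OF assms] by (intro tmap_enc) (simp add: Id_op tkey_enc)
qed (simp add: tid_op_keys_def)

lemma tid_var_pins_enc:
  assumes "e \<in> idents M"
  shows "tid_var_pins e (enc_structure H) = enc_list enc_pin (id_var_pins H e)"
proof (cases e)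
  case (Id_var i xs y)
  show ?thesis
    unfolding Id_var tid_var_pins_def ident.case id_var_pins.simps tvals_enc
  proof (rule tmap_enc)
    fix l assume l: "l \<in> set (vals H)"
    then have "length l = K" by (simp add: set_vals)
    then show "Node (tkey i xs (enc_list enc_nat l)) (tnth (enc_list enc_nat l) (enc_nat y))
        = enc_pin ((i, map ((!) l) xs), l ! y)"
      using K[OF assms] by (simp add: Id_var tkey_enc[OF l] tnth_enc)
  qed
qed (simp add: tid_var_pins_def)

lemma tpin_block_enc: "tpin_block (enc_list enc_pin pins) (enc_nat a) = enc_block (pin_block pins a)"
proof -
  have "tfilter (\<lambda>p. enc_bool (right p = enc_nat a)) (enc_list enc_pin pins)
      = enc_list enc_pin (filter (\<lambda>p. snd p = a) pins)"
    by (rule tfilter_enc) simp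
  moreover have "tmap (\<lambda>p. Node (left p) Leaf) (enc_list enc_pin ps)
      = enc_list (enc_list enc_key) (map (\<lambda>p. [fst p]) ps)" for ps
    by (rule tmap_enc) simp
  ultimately show ?thesis
    by (simp add: tpin_block_def pin_block_def)
qed

lemma tblocks_enc:
  assumes "is_structure H"
  shows "tblocks (enc_structure H) (enc_list enc_pin pins) = enc_list enc_block (blocks H pins)"
proof -
  have "tmap (\<lambda>R. Node (left R) (Node (right R) (trel_keys R))) (enc_list enc_rel (rels H))
      = enc_list enc_block (map (\<lambda>(r, ts). (r, ts, rel_keys M r ts)) (rels H))"
    by (rule tmap_enc)
      (use is_structureD[OF assms] in \<open>auto simp: enc_rel_def intro!: trel_keys_enc\<close>)
  moreover have "tmap (\<lambda>a. Node a (Node a Leaf)) (enc_list enc_nat [0..<univ_size H])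
      = enc_list (enc_list enc_nat) (map (\<lambda>a. [a, a]) [0..<univ_size H])"
    by (rule tmap_enc) simp
  moreover have "tconcat (enc_list (\<lambda>e. tid_op_keys e (enc_structure H)) es)
      = enc_list (enc_list enc_key) (concat (map (id_op_keys H) es))"
    by (rule tconcat_enc) (simp add: tid_op_keys_enc set_es)
  moreover have "tconcat (enc_list (\<lambda>e. tid_var_pins e (enc_structure H)) es)
      = enc_list enc_pin (id_pins H)"
    unfolding id_pins_def by (rule tconcat_enc) (simp add: tid_var_pins_enc set_es)
  moreover have "tmap (\<lambda>a. tpin_block (enc_list enc_pin ps) a) (enc_list enc_nat [0..<univ_size H])
      = enc_list enc_block (map (pin_block ps) [0..<univ_size H])" for ps
    by (rule tmap_enc) (simp add: tpin_block_enc)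
  ultimately show ?thesis
    unfolding tblocks_def blocks_def
    by (simp add: tappend_enc flip: enc_block.simps enc_list.simps(2))
qed

lemma tindex_enc: "tindex (enc_list enc_key (keys M H)) (enc_key k) = enc_nat (key_index M H k)"
  by (simp add: tindex_def foldl_tindex key_index_def rev_map takeWhile_map comp_def)

lemma tindicator_enc:
  assumes "is_structure H"
  shows "tindicator (enc_structure H) (enc_list enc_pin pins) = enc_structure (indicator H pins)"
proof -
  have "tmap (\<lambda>k. Leaf) (enc_list enc_key (keys M H)) = enc_nat (length (keys M H))"
    using tmap_enc[of "keys M H" "\<lambda>_. Leaf" enc_key "\<lambda>_. Leaf" "\<lambda>k. k"]
    by (simp add: enc_list_Leaf)
  moreover have "tmap (\<lambda>b. Node (left b)
      (tmap (\<lambda>kt. tmap (\<lambda>k. tindex (enc_list enc_key (keys M H)) k) kt) (right (right b))))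
      (enc_list enc_block bs)
    = enc_list enc_rel (map (\<lambda>(r, ts, kts). (r, map (map (key_index M H)) kts)) bs)" for bs
  proof (rule tmap_enc)
    have "tmap (\<lambda>k. tindex (enc_list enc_key (keys M H)) k) (enc_list enc_key kt)
        = enc_list enc_nat (map (key_index M H) kt)" for kt
      by (rule tmap_enc) (rule tindex_enc)
    then have "tmap (\<lambda>kt. tmap (\<lambda>k. tindex (enc_list enc_key (keys M H)) k) kt)
        (enc_list (enc_list enc_key) kts)
      = enc_list (enc_list enc_nat) (map (map (key_index M H)) kts)" for kts
      by (rule tmap_enc)
    then show "Node (left (enc_block b)) (tmap (\<lambda>kt. tmap (\<lambda>k. tindex (enc_list enc_key (keys M H)) k) kt)
        (right (right (enc_block b))))
      = enc_rel (case b of (r, ts, kts) \<Rightarrow> (r, map (map (key_index M H)) kts))" for b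
      by (cases b) (simp add: enc_rel_def)
  qed
  ultimately show ?thesis
    by (simp add: tindicator_def tkeys_enc tblocks_enc[OF assms] indicator_def) (simp add: enc_structure_def)
qed

lemma texpansion_enc:
  assumes "is_structure H"
  shows "texpansion (enc_structure H) = enc_structure (expansion H)"
proof -
  have "tmap (\<lambda>b. Node (left b) (left (right b))) (enc_list enc_block bs)
      = enc_list enc_rel (map (\<lambda>(r, ts, kts). (r, ts)) bs)" for bs
    by (rule tmap_enc) (auto simp: enc_rel_def)
  then show ?thesis
    using tblocks_enc[OF assms, of "[]"]
    by (simp add: texpansion_def expansion_def) (simp add: enc_structure_def)
qed

lemma tpick_enc:
  assumes "is_structure H"
  shows "tpick (enc_structure H) (enc_list enc_pin asg) (enc_key k) = enc_nat (pick H asg k)"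
proof -
  have "tfilter (\<lambda>a. U (Node (tindicator (enc_structure H) (Node (Node (enc_key k) a)
      (enc_list enc_pin asg))) (texpansion (enc_structure H)))) (enc_list enc_nat [0..<univ_size H])
    = enc_list enc_nat (filter (\<lambda>a. query H ((k, a) # asg)) [0..<univ_size H])"
    by (rule tfilter_enc)
      (simp add: query_def texpansion_enc[OF assms] flip: enc_pin.simps enc_list.simps(2)
        tindicator_enc[OF assms])
  then show ?thesis
    by (simp add: tpick_def pick_def split: list.split)
qed

lemma tgreedy_enc:
  assumes "is_structure H"
  shows "tgreedy (enc_structure H) = enc_list enc_pin (greedy H)"
proof -
  have "foldl (\<lambda>asg k. Node (Node k (tpick (enc_structure H) asg k)) asg) (enc_list enc_pin asg)
      (map enc_key ks) = enc_list enc_pin (foldl (extend H) asg ks)" for asg ks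
    by (induction ks arbitrary: asg)
      (simp_all add: tpick_enc[OF assms] extend_def flip: enc_pin.simps enc_list.simps(2))
  from this[of "[]"] show ?thesis
    by (simp add: tgreedy_def tkeys_enc greedy_def)
qed

lemma tviolated_enc:
  assumes "is_structure H"
  shows "tviolated (enc_structure H) (enc_list enc_pin asg) = Leaf \<longleftrightarrow>
    satisfied (lookup asg) (blocks H [])"
proof -
  have lookup: "tmap (\<lambda>k. tlookup k (enc_list enc_pin asg)) (enc_list enc_key kt)
      = enc_list enc_nat (map (lookup asg) kt)" for kt
    by (rule tmap_enc) (rule tlookup_enc)
  have member: "tfilter (\<lambda>u. enc_bool (u = enc_list enc_nat v)) (enc_list (enc_list enc_nat) ts)
      = enc_list (enc_list enc_nat) (filter (\<lambda>u. u = v) ts)" for v ts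
    by (rule tfilter_enc) simp
  have "tviolated (enc_structure H) (enc_list enc_pin asg) = enc_list (enc_list enc_key)
    (concat (map (\<lambda>(r, ts, kts). filter (\<lambda>kt. map (lookup asg) kt \<notin> set ts) kts) (blocks H [])))"
    unfolding tviolated_def tblocks_enc[OF assms, of "[]", simplified]
  proof (rule tconcat_map_enc)
    fix b :: block
    obtain r ts kts where b: "b = (r, ts, kts)" by (cases b)
    show "tfilter (\<lambda>kt. if tfilter (\<lambda>u. enc_bool (u = tmap (\<lambda>k. tlookup k (enc_list enc_pin asg)) kt))
          (left (right (enc_block b))) = Leaf then Node Leaf Leaf else Leaf) (right (right (enc_block b)))
      = enc_list (enc_list enc_key) (case b of (r, ts, kts) \<Rightarrow>
          filter (\<lambda>kt. map (lookup asg) kt \<notin> set ts) kts)"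
      unfolding b enc_block.simps left.simps right.simps prod.case
      by (rule tfilter_enc) (auto simp: lookup member filter_empty_conv)
  qed
  then show ?thesis
    by (auto simp: satisfied_def filter_empty_conv)
qed

lemma ttables_enc:
  "ttables (enc_structure H) (enc_list enc_pin asg)
    = enc_list enc_table (op_tables H M (ops M (lookup asg)))"
proof -
  have "op_tables H M (ops M (lookup asg))
      = map (\<lambda>i. op_table (univ_size H) (op_arities M ! i) (\<lambda>a. lookup asg (i, a)))
          [0..<length (op_arities M)]"
    by (intro nth_equalityI) (auto simp: op_tables_def ops_def)
  moreover have "tmap (\<lambda>a. Node a (tlookup (Node (enc_nat i) a) (enc_list enc_pin asg)))
      (tnlists k (enc_list enc_nat [0..<univ_size H]))
    = enc_table (op_table (univ_size H) k (\<lambda>a. lookup asg (i, a)))" for i k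
    unfolding tnlists_enc enc_table_def op_table_def
    by (rule tmap_enc) (simp add: tlookup_enc flip: enc_key.simps)
  ultimately show ?thesis
    by (simp add: ttables_def enc_list_map)
qed

lemma creation_output_tcreate:
  assumes "is_structure H"
  shows "creation_output M H (tcreate (enc_structure H))"
proof -
  note enc = tcreate_def tgreedy_enc[OF assms] tviolated_enc[OF assms] ttables_enc
    lookup_greedy(2)[OF assms]
  show ?thesis
  proof (cases "satisfies H M")
    case True
    then have "satisfying_polymorphisms H (ops M (lookup (greedy H))) M"
      using lookup_greedy[OF assms] satisfied_blocks[OF assms] by blast
    with True show ?thesis
      by (auto simp: creation_output_def enc)
  qed (simp add: creation_output_def enc)
qed

lemma creation_polytime: "creation_metaquestion_polytime M"
  unfolding creation_metaquestion_polytime_def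
  using pt_tcreate creation_output_tcreate by blast

end

section \<open>Reductions between the three problems\<close>

lemma uniform_if_creation_and_semiuniform:
  assumes "creation_metaquestion_polytime M" "has_semiuniform_polytime_algorithm M"
  shows "has_uniform_polytime_algorithm M"
proof -
  obtain create where create: "polytime_computable create"
    "\<And>H. is_structure H \<Longrightarrow> creation_output M H (create (enc_structure H))"
    using assms(1) by (auto simp: creation_metaquestion_polytime_def)
  obtain solve where solve: "polytime_computable solve"
    "\<And>G H fs. csp_instance G H \<Longrightarrow> satisfying_polymorphisms H fs M \<Longrightarrow>
      solve (Node (Node (enc_structure G) (enc_structure H)) (enc_list enc_table (op_tables H M fs)))
        = enc_bool (yes_instance G H)"
    using assms(2) by (auto simp: has_semiuniform_polytime_algorithm_def)
  \<comment> \<open>Here \<open>right x\<close> is the encoded template, and \<open>left\<close>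
    strips the \<open>Some\<close> from the created tables. After the answer \<open>None\<close> the
    result is arbitrary, but then the promise fails.\<close>
  have "polytime_computable (\<lambda>x. solve (Node x (left (create (right x)))))"
    by (intro pt_compose[OF solve(1)] pt_intros pt_compose[OF create(1)])
  moreover have "solve (Node (Node (enc_structure G) (enc_structure H)) (left (create (enc_structure H))))
      = enc_bool (yes_instance G H)" if GH: "csp_instance G H" and H: "satisfies H M" for G H
  proof -
    have "creation_output M H (create (enc_structure H))"
      using GH create(2) by (simp add: csp_instance_def)
    then obtain fs where "satisfying_polymorphisms H fs M"
      "create (enc_structure H) = Node (enc_list enc_table (op_tables H M fs)) Leaf"
      using H by (auto simp: creation_output_def)
    then show ?thesis using solve(2)[OF GH] by simp
  qed
  ultimately show ?thesis
    unfolding has_uniform_polytime_algorithm_def by (intro exI conjI) auto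
qed

text \<open>The tables are discarded: that they exist is already the promise
  \<open>satisfies H M\<close>.\<close>

lemma semiuniform_if_uniform:
  assumes "has_uniform_polytime_algorithm M"
  shows "has_semiuniform_polytime_algorithm M"
proof -
  obtain alg where alg: "polytime_computable alg"
    "\<And>G H. csp_instance G H \<Longrightarrow> satisfies H M \<Longrightarrow>
      alg (Node (enc_structure G) (enc_structure H)) = enc_bool (yes_instance G H)"
    using assms by (auto simp: has_uniform_polytime_algorithm_def)
  have "polytime_computable (\<lambda>x. alg (left x))"
    by (intro pt_compose[OF alg(1)] pt_intros)
  moreover have "satisfies H M" if "satisfying_polymorphisms H fs M" for H fs
    using that by (auto simp: satisfies_def)
  ultimately show ?thesis
    unfolding has_semiuniform_polytime_algorithm_def
    using alg(2) by (intro exI conjI) auto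
qed

lemma creation_if_uniform:
  assumes "strong_linear_maltsev M" "idempotent M" "has_uniform_polytime_algorithm M"
  shows "creation_metaquestion_polytime M"
proof -
  obtain U where U: "polytime_computable U"
    "\<And>G H. csp_instance G H \<Longrightarrow> satisfies H M \<Longrightarrow>
      U (Node (enc_structure G) (enc_structure H)) = enc_bool (yes_instance G H)"
    using assms(3) by (auto simp: has_uniform_polytime_algorithm_def)
  have fin: "finite (idents M)"
    using assms(1) by (simp add: strong_linear_maltsev_def)
  \<comment> \<open>Both \<open>es\<close> and \<open>K\<close> depend on \<open>M\<close> alone, so
    they are built into the program and need not be computed by it.\<close>
  then obtain es where es: "set es = idents M"
    using finite_list by blast
  have "finite (\<Union>e \<in> idents M. vars_ident e)"
    using fin finite_vars_ident by blast
  then obtain K where K: "(\<Union>e \<in> idents M. vars_ident e) \<subseteq> {..<K}"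
    using finite_nat_iff_bounded by blast
  interpret creation M es K U
    by standard (use assms(1,2) es K U in auto)
  show ?thesis by (rule creation_polytime)
qed

theorem theorem4p7:
  fixes M :: maltsev_condition
  assumes "strong_linear_maltsev M"
  shows "(creation_metaquestion_polytime M \<and> has_semiuniform_polytime_algorithm M \<longrightarrow>
            has_uniform_polytime_algorithm M)
       \<and> (idempotent M \<longrightarrow>
            (has_uniform_polytime_algorithm M \<longrightarrow>
               creation_metaquestion_polytime M \<and> has_semiuniform_polytime_algorithm M))"
  using uniform_if_creation_and_semiuniform semiuniform_if_uniform creation_if_uniform[OF assms]
  by blast

end
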